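(* Let $n\geq 2$ and $1\le p\leq n$, and let $f\colon M^{2n}\to\mathbb{R}^{2n+p}$ be a real Kaehler submanifold, that is, an isometric immersion of a Kaehler manifold $(M^{2n},J)$ of complex dimension $n$ into Euclidean space $\mathbb{R}^{2n+p}$. For $x\in M^{2n}$ let $\kappa(x)$ be the dimension of the first normal space of $f$ at $x$ and let $\nu^c_s(x)$, $1\leq s\leq\kappa(x)$, be the complex $s$-nullities of $f$ at $x$ (defined in the context). Assume that there is an open dense subset $U$ of $M^{2n}$ such that at each point $x\in U$ at least one of the following holds: (i) $\nu^c_1(x)<2n-2$ and $\nu^c_{2s}(x)<2n-4s$ for all integers $s\geq 1$; (ii) $\nu^c_{2s+1}(x)<2n-4s-2$ for all integers $s\geq 0$; where in (i) and (ii) each inequality on $\nu^c_j(x)$ is required for those indices $j$ for which $\nu^c_j(x)$ is defined, that is, $1\leq j\leq \kappa(x)$. Then $f$ is a minimal submanifold.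
   Context: Let $\alpha\colon TM\times TM\to N_fM$ be the second fundamental form of $f$, with values in the normal bundle $N_fM$. The first normal space of $f$ at $x$ is $N_1(x)=\operatorname{span}\{\alpha(X,Y)\colon X,Y\in T_xM\}\subset N_fM(x)$, and $\kappa(x)=\dim N_1(x)\leq p$. For an $s$-dimensional vector subspace $U^s\subset N_1(x)$ let $\pi_{U^s}\colon N_1(x)\to U^s$ be the orthogonal projection and $\alpha_{U^s}=\pi_{U^s}\circ\alpha$. Set $$\mathcal{N}_c(\alpha_{U^s})=\{Y\in T_xM\colon \alpha_{U^s}(X,Y)=\alpha_{U^s}(X,JY)=0\ \text{for all}\ X\in T_xM\}$$ and let $\nu^c(\alpha_{U^s})$ be its real dimension. For $1\leq s\leq\kappa(x)$ the complex $s$-nullity of $f$ at $x$ is $$\nu^c_s(x)=\max_{U^s\subset N_1(x)}\nu^c(\alpha_{U^s}),$$ the maximum being over all $s$-dimensional subspaces $U^s$ of $N_1(x)$. The choice between (i) and (ii) may depend on the point $x$. Minimal means that the mean curvature vector (the trace of $\alpha$) vanishes identically. *)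

theory Defs
  imports "HOL-Analysis.Analysis"
begin

section \<open>Smooth functions between Euclidean spaces\<close>

text \<open>On an open subset of a finite-dimensional space the following is the usual
  \<open>C\<^sup>k\<close>: all iterated directional derivatives up to order \<open>k\<close> exist and are continuous.\<close>

primrec C_k_on :: "nat \<Rightarrow> ('a::real_normed_vector \<Rightarrow> 'b::real_normed_vector) \<Rightarrow> 'a set \<Rightarrow> bool"
where
  "C_k_on 0 f S \<longleftrightarrow> continuous_on S f"
| "C_k_on (Suc k) f S \<longleftrightarrow>
     (\<forall>x\<in>S. f differentiable (at x)) \<and>
     (\<forall>v. C_k_on k (\<lambda>x. frechet_derivative f (at x) v) S)"

definition smooth_on ::
  "('a::real_normed_vector \<Rightarrow> 'b::real_normed_vector) \<Rightarrow> 'a set \<Rightarrow> bool"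
where
  "smooth_on f S \<longleftrightarrow> (\<forall>k. C_k_on k f S)"

section \<open>Smooth manifolds\<close>

text \<open>The manifold is a whole type \<open>'m\<close> of class \<open>t2_space\<close> and
  \<open>second_countable_topology\<close>. A chart is a pair of a domain and a coordinate map; the values
  of the coordinate map outside the domain are irrelevant. The atlas need not be maximal.\<close>

type_synonym ('m, 'e) chart = "'m set \<times> ('m \<Rightarrow> 'e)"

definition chart_img :: "('m, 'e) chart \<Rightarrow> 'e set" where
  "chart_img c = snd c ` fst c"

definition chart_inv :: "('m, 'e) chart \<Rightarrow> 'e \<Rightarrow> 'm" where
  "chart_inv c = inv_into (fst c) (snd c)"

definition smooth_atlas ::
  "('m::{t2_space,second_countable_topology}, 'e::euclidean_space) chart set \<Rightarrow> bool"
where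
  "smooth_atlas A \<longleftrightarrow>
     (\<Union>c\<in>A. fst c) = UNIV \<and>
     (\<forall>c\<in>A. open (fst c) \<and> open (chart_img c) \<and>
        homeomorphism (fst c) (chart_img c) (snd c) (chart_inv c)) \<and>
     (\<forall>c\<in>A. \<forall>d\<in>A. smooth_on (snd d \<circ> chart_inv c) (snd c ` (fst c \<inter> fst d)))"

text \<open>The tangent space at \<open>x\<close> is the model space \<open>'e\<close>, a vector \<open>u\<close> standing for the tangent
  vector with coordinates \<open>u\<close> in the chart \<open>chart_at A x\<close>. A tensor field therefore assigns to
  \<open>x\<close> a tensor on \<open>'e\<close>. Its components in another chart \<open>c\<close> are obtained by means of
  \<open>coord_change\<close>, and it is smooth if its components in every chart are.\<close>

definition chart_at :: "('m, 'e) chart set \<Rightarrow> 'm \<Rightarrow> ('m, 'e) chart" where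
  "chart_at A x = (SOME c. c \<in> A \<and> x \<in> fst c)"

definition coord_change ::
  "('m, 'e::euclidean_space) chart \<Rightarrow> ('m, 'e) chart \<Rightarrow> 'm \<Rightarrow> 'e \<Rightarrow> 'e"
where
  "coord_change c d x = frechet_derivative (snd d \<circ> chart_inv c) (at (snd c x))"

definition metric_in ::
  "('m, 'e::euclidean_space) chart set \<Rightarrow> ('m \<Rightarrow> 'e \<Rightarrow> 'e \<Rightarrow> real) \<Rightarrow> ('m, 'e) chart \<Rightarrow>
    'e \<Rightarrow> 'e \<Rightarrow> 'e \<Rightarrow> real"
where
  "metric_in A g c y u v =
     (let x = chart_inv c y; T = coord_change c (chart_at A x) x in g x (T u) (T v))"

definition endo_in ::
  "('m, 'e::euclidean_space) chart set \<Rightarrow> ('m \<Rightarrow> 'e \<Rightarrow> 'e) \<Rightarrow> ('m, 'e) chart \<Rightarrow>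
    'e \<Rightarrow> 'e \<Rightarrow> 'e"
where
  "endo_in A J c y u =
     (let x = chart_inv c y
      in coord_change (chart_at A x) c x (J x (coord_change c (chart_at A x) x u)))"

section \<open>Kaehler manifolds\<close>

definition riemannian_metric ::
  "('m::{t2_space,second_countable_topology}, 'e::euclidean_space) chart set \<Rightarrow>
    ('m \<Rightarrow> 'e \<Rightarrow> 'e \<Rightarrow> real) \<Rightarrow> bool"
where
  "riemannian_metric A g \<longleftrightarrow>
     (\<forall>x. bilinear (g x) \<and> (\<forall>u v. g x u v = g x v u) \<and> (\<forall>u. u \<noteq> 0 \<longrightarrow> g x u u > 0)) \<and>
     (\<forall>c\<in>A. \<forall>u v. smooth_on (\<lambda>y. metric_in A g c y u v) (chart_img c))"

definition almost_complex_structure ::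
  "('m::{t2_space,second_countable_topology}, 'e::euclidean_space) chart set \<Rightarrow>
    ('m \<Rightarrow> 'e \<Rightarrow> 'e) \<Rightarrow> bool"
where
  "almost_complex_structure A J \<longleftrightarrow>
     (\<forall>x. linear (J x) \<and> (\<forall>u. J x (J x u) = - u)) \<and>
     (\<forall>c\<in>A. \<forall>u. smooth_on (\<lambda>y. endo_in A J c y u) (chart_img c))"

text \<open>The Levi-Civita connection in coordinates: \<open>levi_civita G y u v\<close> is the covariant
  derivative at \<open>y\<close>, in direction \<open>u\<close>, of the constant coordinate vector field \<open>v\<close> for the
  metric with components \<open>G\<close>. It is determined by the Koszul formula, whose bracket terms
  vanish for constant coordinate fields.\<close>

definition levi_civita ::
  "('e::euclidean_space \<Rightarrow> 'e \<Rightarrow> 'e \<Rightarrow> real) \<Rightarrow> 'e \<Rightarrow> 'e \<Rightarrow> 'e \<Rightarrow> 'e"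
where
  "levi_civita G y u v =
     (THE z. \<forall>w. 2 * G y z w =
         frechet_derivative (\<lambda>y'. G y' v w) (at y) u
       + frechet_derivative (\<lambda>y'. G y' u w) (at y) v
       - frechet_derivative (\<lambda>y'. G y' u v) (at y) w)"

text \<open>\<open>J\<close> is parallel: for a constant coordinate field \<open>v\<close>, the covariant derivative of the
  field \<open>J v\<close> in direction \<open>u\<close> equals \<open>J\<close> applied to the covariant derivative of \<open>v\<close>.\<close>

definition parallel_endo ::
  "('m::{t2_space,second_countable_topology}, 'e::euclidean_space) chart set \<Rightarrow>
    ('m \<Rightarrow> 'e \<Rightarrow> 'e \<Rightarrow> real) \<Rightarrow> ('m \<Rightarrow> 'e \<Rightarrow> 'e) \<Rightarrow> bool"
where
  "parallel_endo A g J \<longleftrightarrow>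
     (\<forall>c\<in>A. \<forall>y\<in>chart_img c. \<forall>u v.
        frechet_derivative (\<lambda>y'. endo_in A J c y' v) (at y) u
          + levi_civita (metric_in A g c) y u (endo_in A J c y v)
        = endo_in A J c y (levi_civita (metric_in A g c) y u v))"

definition kaehler_manifold ::
  "('m::{t2_space,second_countable_topology}, 'e::euclidean_space) chart set \<Rightarrow>
    ('m \<Rightarrow> 'e \<Rightarrow> 'e \<Rightarrow> real) \<Rightarrow> ('m \<Rightarrow> 'e \<Rightarrow> 'e) \<Rightarrow> bool"
where
  "kaehler_manifold A g J \<longleftrightarrow>
     smooth_atlas A \<and> riemannian_metric A g \<and> almost_complex_structure A J \<and>
     (\<forall>x u v. g x (J x u) (J x v) = g x u v) \<and>
     parallel_endo A g J"

section \<open>Isometric immersions and the second fundamental form\<close>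

definition differential ::
  "('m, 'e::euclidean_space) chart set \<Rightarrow> ('m \<Rightarrow> 'k::euclidean_space) \<Rightarrow> 'm \<Rightarrow> 'e \<Rightarrow> 'k"
where
  "differential A f x =
     frechet_derivative (f \<circ> chart_inv (chart_at A x)) (at (snd (chart_at A x) x))"

definition isometric_immersion ::
  "('m, 'e::euclidean_space) chart set \<Rightarrow> ('m \<Rightarrow> 'e \<Rightarrow> 'e \<Rightarrow> real) \<Rightarrow>
    ('m \<Rightarrow> 'k::euclidean_space) \<Rightarrow> bool"
where
  "isometric_immersion A g f \<longleftrightarrow>
     (\<forall>c\<in>A. smooth_on (f \<circ> chart_inv c) (chart_img c)) \<and>
     (\<forall>x. inj (differential A f x)) \<and>
     (\<forall>x u v. differential A f x u \<bullet> differential A f x v = g x u v)"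

definition normal_space ::
  "('m, 'e::euclidean_space) chart set \<Rightarrow> ('m \<Rightarrow> 'k::euclidean_space) \<Rightarrow> 'm \<Rightarrow> 'k set"
where
  "normal_space A f x = (range (differential A f x))\<^sup>\<bottom>"

definition orth_proj :: "'k::euclidean_space set \<Rightarrow> 'k \<Rightarrow> 'k" where
  "orth_proj S v = (THE w. w \<in> S \<and> v - w \<in> S\<^sup>\<bottom>)"

text \<open>By the Gauss formula the second fundamental form is the normal component of the ambient
  derivative, in direction \<open>u\<close>, of \<open>f\<^sub>* V\<close> for any vector field \<open>V\<close> extending \<open>v\<close>. Here \<open>V\<close> is
  the field that is constant in the chart at \<open>x\<close>.\<close>

definition second_ff ::
  "('m, 'e::euclidean_space) chart set \<Rightarrow> ('m \<Rightarrow> 'k::euclidean_space) \<Rightarrow> 'm \<Rightarrow> 'e \<Rightarrow> 'e \<Rightarrow> 'k"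
where
  "second_ff A f x u v =
     orth_proj (normal_space A f x)
       (frechet_derivative
          (\<lambda>y. frechet_derivative (f \<circ> chart_inv (chart_at A x)) (at y) v)
          (at (snd (chart_at A x) x)) u)"

definition first_normal_space ::
  "('m, 'e::euclidean_space) chart set \<Rightarrow> ('m \<Rightarrow> 'k::euclidean_space) \<Rightarrow> 'm \<Rightarrow> 'k set"
where
  "first_normal_space A f x = span {second_ff A f x u v | u v. True}"

definition first_normal_dim ::
  "('m, 'e::euclidean_space) chart set \<Rightarrow> ('m \<Rightarrow> 'k::euclidean_space) \<Rightarrow> 'm \<Rightarrow> nat"
where
  "first_normal_dim A f x = dim (first_normal_space A f x)"

section \<open>Complex nullities\<close>

definition complex_null_space ::
  "('m, 'e::euclidean_space) chart set \<Rightarrow> ('m \<Rightarrow> 'e \<Rightarrow> 'e) \<Rightarrow> ('m \<Rightarrow> 'k::euclidean_space) \<Rightarrow>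
    'm \<Rightarrow> 'k set \<Rightarrow> 'e set"
where
  "complex_null_space A J f x U =
     {v. \<forall>u. orth_proj U (second_ff A f x u v) = 0 \<and>
             orth_proj U (second_ff A f x u (J x v)) = 0}"

text \<open>Only meaningful for \<open>1 \<le> s \<le> first_normal_dim A f x\<close>; for larger \<open>s\<close> it is the maximum of
  the empty set.\<close>

definition complex_nullity ::
  "('m, 'e::euclidean_space) chart set \<Rightarrow> ('m \<Rightarrow> 'e \<Rightarrow> 'e) \<Rightarrow> ('m \<Rightarrow> 'k::euclidean_space) \<Rightarrow>
    nat \<Rightarrow> 'm \<Rightarrow> nat"
where
  "complex_nullity A J f s x =
     Max {dim (complex_null_space A J f x U) | U.
            subspace U \<and> U \<subseteq> first_normal_space A f x \<and> dim U = s}"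

section \<open>Minimal immersions\<close>

definition orthonormal_frame :: "('e::euclidean_space \<Rightarrow> 'e \<Rightarrow> real) \<Rightarrow> 'e set \<Rightarrow> bool" where
  "orthonormal_frame b B \<longleftrightarrow>
     finite B \<and> card B = DIM('e) \<and> (\<forall>u\<in>B. \<forall>v\<in>B. b u v = (if u = v then 1 else 0))"

text \<open>The trace of the second fundamental form with respect to the metric; it does not depend on
  the choice of the orthonormal frame, and it is not divided by the dimension.\<close>

definition mean_curvature ::
  "('m, 'e::euclidean_space) chart set \<Rightarrow> ('m \<Rightarrow> 'e \<Rightarrow> 'e \<Rightarrow> real) \<Rightarrow>
    ('m \<Rightarrow> 'k::euclidean_space) \<Rightarrow> 'm \<Rightarrow> 'k"
where
  "mean_curvature A g f x =
     (\<Sum>v\<in>(SOME B. orthonormal_frame (g x) B). second_ff A f x v v)"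

definition minimal_immersion ::
  "('m, 'e::euclidean_space) chart set \<Rightarrow> ('m \<Rightarrow> 'e \<Rightarrow> 'e \<Rightarrow> real) \<Rightarrow>
    ('m \<Rightarrow> 'k::euclidean_space) \<Rightarrow> bool"
where
  "minimal_immersion A g f \<longleftrightarrow> (\<forall>x. mean_curvature A g f x = 0)"

end

theory Submission
  imports Defs "HOL-Computational_Algebra.Fundamental_Theorem_Algebra"
begin

text \<open>
  Put \<open>P(X, Y) = \<alpha>(X, Y) + \<alpha>(J X, J Y)\<close>. The form \<open>h(X, Y) = P(X, Y) + \<i> P(X, J Y)\<close> with values in the
  complexified normal space is hermitian, and the Gauss equation together with the symmetries of a
  Kaehler curvature tensor makes it flat for the complex bilinear extension of the inner product.
  Let \<open>L\<close> be the real span of the values of \<open>P\<close> at a point and \<open>l = dim L\<close>. Since \<open>h(Z, Z)\<close> is real, an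
  isotropic \<open>h(Z, Z)\<close> vanishes; this forces the kernel of \<open>h(\<cdot>, A)\<close>, for \<open>A\<close> of maximal rank, to be the
  nullity of \<open>h\<close>, which is the complex nullity of \<open>\<alpha>\<^sub>L\<close>. Hence \<open>\<nu>\<^sub>l \<ge> 2n - 2l\<close>.
  If the rank is less than \<open>l\<close>, any hyperplane of \<open>L\<close> shows \<open>\<nu>\<^bsub>l-1\<^esub> \<ge> 2n - 2(l-1)\<close>. If it is \<open>l\<close>, the
  operators \<open>h(\<cdot>, B) \<circ> h(\<cdot>, A)\<^sup>-\<^sup>1\<close> commute, and a common eigenvector yields a vector \<open>e\<close> with
  \<open>h(e, \<cdot>)\<close> of rank one, so that the hyperplane of \<open>L\<close> orthogonal to \<open>h(e, e)\<close> shows the same. One of \<open>l\<close>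
  and \<open>l - 1\<close> is even and the other is odd, so for \<open>l \<ge> 1\<close> both (i) and (ii) fail. Hence \<open>P = 0\<close> on a dense
  set, by continuity everywhere, and a frame \<open>v\<close> and its image \<open>J v\<close> give opposite traces of \<open>\<alpha>\<close>.
\<close>

section \<open>Linear algebra over the complex numbers\<close>

lemma dim_range_plus_dim_kernel:
  fixes f :: "'a::euclidean_space \<Rightarrow> 'b::euclidean_space"
  assumes "linear f"
  shows "dim (range f) + dim {x. f x = 0} = DIM('a)"
proof -
  let ?N = "{x. f x = 0}"
  let ?K = "{y. \<forall>x\<in>?N. orthogonal x y}"
  have N: "subspace ?N"
    using assms by (rule linear_subspace_kernel)
  have K: "subspace ?K"
    by (rule subspace_orthogonal_to_vectors)
  have dim: "dim ?K + dim ?N = DIM('a)"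
    using dim_subspace_orthogonal_to_vectors[OF N subspace_UNIV] by simp
  have "inj_on f ?K"
    using assms K by (force simp: linear_injective_on_subspace_0 orthogonal_self)
  then have "dim (f ` ?K) = dim ?K"
    by (intro dim_image_eq[OF assms]) (use K in \<open>simp add: span_eq_iff[THEN iffD2]\<close>)
  moreover have "range f = f ` ?K"
  proof -
    have "f x \<in> f ` ?K" for x
    proof -
      obtain y z where yz: "y \<in> span ?N" "\<And>w. w \<in> span ?N \<Longrightarrow> orthogonal z w" "x = y + z"
        using orthogonal_subspace_decomp_exists[of ?N x] by metis
      have "f y = 0"
        using yz(1) N by (simp add: span_eq_iff[THEN iffD2])
      moreover have "z \<in> ?K"
        using yz(2) by (auto simp: orthogonal_commute span_base)
      ultimately show ?thesis
        using yz(3) assms by (simp add: linear_add)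
    qed
    then show ?thesis by auto
  qed
  ultimately show ?thesis using dim by simp
qed

section \<open>Complex vectors and the bilinear extension of the inner product\<close>

lemma linear_vector_scalar_mult_complex: "linear (\<lambda>u::complex^'n. c *s u)"
  by (rule linearI) (simp_all add: vec_eq_iff algebra_simps)

lemma scaleR_eq_vector_scalar_mult: "r *\<^sub>R u = complex_of_real r *s u" for u :: "complex^'n"
  by (simp add: vec_eq_iff scaleR_conv_of_real[symmetric] del: mult_cancel_right)

lemma inner_imaginary_scalar_mult:
  fixes u v :: "complex^'n"
  shows "(\<i> *s u) \<bullet> v = - (u \<bullet> (\<i> *s v))"
  by (simp add: inner_vec_def inner_complex_def sum_negf[symmetric] algebra_simps)

definition cplx :: "real^'n \<Rightarrow> real^'n \<Rightarrow> complex^'n" where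
  "cplx p q = (\<chi> i. Complex (p $ i) (q $ i))"

definition vRe :: "complex^'n \<Rightarrow> real^'n" where
  "vRe u = (\<chi> i. Re (u $ i))"

definition vIm :: "complex^'n \<Rightarrow> real^'n" where
  "vIm u = (\<chi> i. Im (u $ i))"

definition cconj :: "complex^'n \<Rightarrow> complex^'n" where
  "cconj u = (\<chi> i. cnj (u $ i))"

text \<open>Bilinear over the complex numbers, not hermitian, so isotropic vectors exist.
  Definiteness survives only in pairing a vector with its own conjugate.\<close>

definition cform :: "complex^'n \<Rightarrow> complex^'n \<Rightarrow> complex" where
  "cform u v = (\<Sum>i\<in>UNIV. u $ i * v $ i)"

lemma cform_simps:
  "cform (u + v) w = cform u w + cform v w"
  "cform w (u + v) = cform w u + cform w v"
  "cform (u - v) w = cform u w - cform v w"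
  "cform w (u - v) = cform w u - cform w v"
  "cform (c *s u) w = c * cform u w"
  "cform w (c *s u) = c * cform w u"
  "cform 0 w = 0" "cform w 0 = 0"
  by (simp_all add: cform_def algebra_simps sum.distrib sum_subtractf sum_distrib_left)

lemma cform_commute: "cform u v = cform v u"
  by (simp add: cform_def mult.commute)

lemma cform_cconj: "cform (cconj u) u = of_real ((norm u)\<^sup>2)"
  by (simp add: cform_def cconj_def norm_vec_def L2_set_def sum_nonneg mult.commute
      complex_norm_square flip: of_real_power)

lemma cform_cconj_eq_0: "cform (cconj u) u = 0 \<longleftrightarrow> u = 0"
  by (simp add: cform_cconj)

lemma cform_cplx: "cform (cplx p q) (cplx r s) = Complex (p \<bullet> r - q \<bullet> s) (p \<bullet> s + q \<bullet> r)"
  by (simp add: cform_def cplx_def inner_vec_def complex_eq_iff sum.distrib sum_subtractf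
      algebra_simps)

lemma cplx_vRe_vIm: "cplx (vRe u) (vIm u) = u"
  by (simp add: cplx_def vRe_def vIm_def)

lemma vRe_cplx [simp]: "vRe (cplx p q) = p" and vIm_cplx [simp]: "vIm (cplx p q) = q"
  by (simp_all add: cplx_def vRe_def vIm_def vec_eq_iff)

lemma cplx_add: "cplx p q + cplx r s = cplx (p + r) (q + s)"
  by (simp add: cplx_def vec_eq_iff complex_eq_iff)

lemma cplx_scaleR: "a *\<^sub>R cplx p q = cplx (a *\<^sub>R p) (a *\<^sub>R q)"
  by (simp add: cplx_def vec_eq_iff complex_eq_iff)

lemma imaginary_cplx: "\<i> *s cplx p q = cplx (- q) p"
  by (simp add: cplx_def vec_eq_iff complex_eq_iff)

lemma cconj_cplx: "cconj (cplx p q) = cplx p (- q)"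
  by (simp add: cconj_def cplx_def vec_eq_iff complex_eq_iff)

lemma cplx_eq_0_iff: "cplx p q = 0 \<longleftrightarrow> p = 0 \<and> q = 0"
  by (auto simp: cplx_def vec_eq_iff complex_eq_iff)

lemma linear_vRe: "linear vRe" and linear_vIm: "linear vIm"
  by (auto intro!: linearI simp: vRe_def vIm_def vec_eq_iff)

text \<open>Conjugating a value of a hermitian form swaps its arguments, so this puts real parts of
  values into the complex span of the values.\<close>

lemma vRe_eq_cconj: "cplx (vRe u) 0 = (1/2) *\<^sub>R (u + cconj u)"
  by (simp add: cplx_def vRe_def cconj_def vec_eq_iff complex_eq_iff)

text \<open>The complexification of \<open>L\<close>, kept as a real subspace because
  \<open>dim\<close> counts real dimensions; being complex then means being stable under
  \<i>.\<close>

definition complexify :: "(real^'n) set \<Rightarrow> (complex^'n) set" where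
  "complexify L = {u. vRe u \<in> L \<and> vIm u \<in> L}"

lemma subspace_complexify: "subspace L \<Longrightarrow> subspace (complexify L)"
  by (auto simp: complexify_def subspace_def linear_add[OF linear_vRe] linear_add[OF linear_vIm]
     linear_0[OF linear_vRe] linear_0[OF linear_vIm] linear_scale[OF linear_vRe] linear_scale[OF linear_vIm])

lemma complexify_imaginary: "subspace L \<Longrightarrow> u \<in> complexify L \<Longrightarrow> \<i> *s u \<in> complexify L"
  by (subst cplx_vRe_vIm[symmetric]) (auto simp: complexify_def imaginary_cplx subspace_neg)

lemma complexify_cconj: "subspace L \<Longrightarrow> u \<in> complexify L \<Longrightarrow> cconj u \<in> complexify L"
  by (subst cplx_vRe_vIm[symmetric]) (auto simp: complexify_def cconj_cplx subspace_neg)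

lemma dim_complexify:
  assumes "subspace L"
  shows "dim (complexify L) = 2 * dim L"
proof -
  have lin: "linear (\<lambda>(p, q). cplx p q)"
    by (rule linearI) (auto simp: cplx_add cplx_scaleR split: prod.splits)
  have "complexify L = (\<lambda>(p, q). cplx p q) ` (L \<times> L)"
    by (force simp: complexify_def cplx_vRe_vIm image_iff)
  moreover have "inj_on (\<lambda>(p, q). cplx p q) (L \<times> L)"
    by (rule inj_onI) (metis (no_types, lifting) case_prod_conv prod.collapse vIm_cplx vRe_cplx)
  moreover have "span (L \<times> L) = L \<times> L"
    using assms by (metis subspace_Times span_eq_iff)
  ultimately have "dim (complexify L) = dim (L \<times> L)"
    using dim_image_eq[OF lin, of "L \<times> L"] by metis
  then show ?thesis using assms by (simp add: dim_Times)
qed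

text \<open>Complex subspaces, being stable under multiplication by \<open>\<i>\<close>, have even real dimension,
  hence the gap of two.\<close>

lemma dim_proper_complex_subspace:
  fixes S T :: "(complex^'n) set"
  assumes S: "subspace S" and T: "subspace T" and "S \<subset> T"
    and iS: "\<And>u. u \<in> S \<Longrightarrow> \<i> *s u \<in> S" and iT: "\<And>u. u \<in> T \<Longrightarrow> \<i> *s u \<in> T"
  shows "dim S + 2 \<le> dim T"
proof -
  obtain x where x: "x \<in> T" "x \<notin> S" using \<open>S \<subset> T\<close> by blast
  obtain y z where yz: "y \<in> span S" "\<And>w. w \<in> span S \<Longrightarrow> orthogonal z w" "x = y + z"
    using orthogonal_subspace_decomp_exists[of S x] by metis
  have yS: "y \<in> S" using yz(1) S by (simp add: span_eq_iff[THEN iffD2])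
  have "z \<in> T"
    using x yz(3) yS assms(3) subspace_diff[OF T, of x y] by auto
  moreover have z0: "z \<noteq> 0" using x yz(3) yS by auto
  have zS: "z \<bullet> w = 0" if "w \<in> S" for w
    using yz(2)[of w] that by (auto simp: orthogonal_def span_base)
  have "z \<notin> S" using zS z0 by fastforce
  then have d1: "dim (insert z S) = dim S + 1"
    using S by (simp add: dim_insert span_eq_iff[THEN iffD2])
  \<comment> \<open>\<open>S\<close> is stable under \<i>, so skewness makes both \<open>z\<close>
    and \<open>\<i> *s z\<close> orthogonal to \<open>S\<close>; they are also orthogonal to each
    other. If \<open>\<i> *s z - k *\<^sub>R z\<close> were in \<open>S\<close>, then
    \<open>\<i> *s z\<close> would be orthogonal to itself.\<close>
  have "\<i> *s z \<notin> span (insert z S)"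
  proof
    assume "\<i> *s z \<in> span (insert z S)"
    then obtain k where "\<i> *s z - k *\<^sub>R z \<in> S"
      using S by (auto simp: span_insert span_eq_iff[THEN iffD2])
    then have "(\<i> *s z - k *\<^sub>R z) \<bullet> z = 0" "(\<i> *s z - k *\<^sub>R z) \<bullet> (\<i> *s z) = 0"
      using zS iS by (metis inner_commute, metis inner_commute inner_imaginary_scalar_mult neg_0_equal_iff_equal zS)
    moreover have "(\<i> *s z) \<bullet> z = 0"
      using inner_imaginary_scalar_mult[of z z] by (simp add: inner_commute)
    ultimately have "(\<i> *s z) \<bullet> (\<i> *s z) = 0"
      by (simp add: inner_diff_left inner_commute[of z "\<i> *s z"])
    then show False using z0 by (auto simp: vec_eq_iff)
  qed
  then have "dim (insert (\<i> *s z) (insert z S)) = dim S + 2"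
    using d1 by (simp add: dim_insert)
  moreover have "insert (\<i> *s z) (insert z S) \<subseteq> T"
    using \<open>z \<in> T\<close> iT assms(3) by auto
  ultimately show ?thesis by (metis dim_subset)
qed

subsection \<open>Common eigenvectors\<close>

text \<open>Horner's scheme for \<open>p(T) x\<close>.\<close>

definition poly_act :: "(complex^'n \<Rightarrow> complex^'n) \<Rightarrow> complex^'n \<Rightarrow> complex poly \<Rightarrow> complex^'n" where
  "poly_act T x p = fold_coeffs (\<lambda>a v. a *s x + T v) p 0"

lemma poly_act_0 [simp]: "poly_act T x 0 = 0"
  by (simp add: poly_act_def)

lemma poly_act_pCons [simp]:
  assumes "linear T"
  shows "poly_act T x (pCons a p) = a *s x + T (poly_act T x p)"
  using assms by (cases "a = 0 \<and> p = 0") (auto simp: poly_act_def linear_0)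

text \<open>Compatibility with \<i> is asked only on \<open>E\<close>: the operators to which this
  is applied involve a right inverse that is linear over the reals only.\<close>

locale complex_operator =
  fixes T :: "complex^'n \<Rightarrow> complex^'n" and E :: "(complex^'n) set"
  assumes lin: "linear T"
    and E: "subspace E" and iE: "\<And>u. u \<in> E \<Longrightarrow> \<i> *s u \<in> E"
    and TE: "\<And>u. u \<in> E \<Longrightarrow> T u \<in> E" and Ti: "\<And>u. u \<in> E \<Longrightarrow> T (\<i> *s u) = \<i> *s T u"
begin

lemma scalar_mult_decompose: "c *s u = Re c *\<^sub>R u + Im c *\<^sub>R (\<i> *s u)" for u :: "complex^'n"
  by (simp add: vec_eq_iff complex_eq_iff)

lemma scalar_mult_mem: "u \<in> E \<Longrightarrow> c *s u \<in> E"
  by (subst scalar_mult_decompose) (intro subspace_add[OF E] subspace_scale[OF E] iE)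

lemma T_scalar_mult: "u \<in> E \<Longrightarrow> T (c *s u) = c *s T u"
  by (subst (1 2) scalar_mult_decompose) (simp add: linear_add[OF lin] linear_scale[OF lin] Ti)

lemma poly_act_mem: "x \<in> E \<Longrightarrow> poly_act T x p \<in> E"
  by (induction p) (auto simp: lin subspace_0[OF E] intro!: subspace_add[OF E] scalar_mult_mem TE)

lemma poly_act_add: "poly_act T x (p + q) = poly_act T x p + poly_act T x q"
  by (induction p q rule: poly_induct2) (simp_all add: lin linear_add[OF lin] vector_sadd_rdistrib algebra_simps)

lemma poly_act_smult: "x \<in> E \<Longrightarrow> poly_act T x (smult c p) = c *s poly_act T x p"
  by (induction p)
     (simp_all add: lin T_scalar_mult poly_act_mem vector_add_ldistrib vector_smult_assoc)

lemma poly_act_sum: "poly_act T x (\<Sum>i\<in>I. p i) = (\<Sum>i\<in>I. poly_act T x (p i))"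
  by (induction I rule: infinite_finite_induct) (simp_all add: poly_act_add)

text \<open>More iterates of \<open>x\<close> under \<open>T\<close> than the real dimension are
  dependent over the reals, and a real relation is in particular a complex one.\<close>

lemma ex_annihilating_poly:
  assumes "x \<in> E"
  shows "\<exists>p. p \<noteq> 0 \<and> poly_act T x p = 0"
proof -
  define N where "N = DIM(complex^'n)"
  define w where "w i = poly_act T x (monom 1 i)" for i
  show ?thesis
  \<comment> \<open>\<open>dependent\<close> speaks of a set and does not see repetitions, so two
    equal iterates are treated apart.\<close>
  proof (cases "inj_on w {..N}")
    case False
    then obtain i j where "i \<noteq> j" "w i = w j" by (auto simp: inj_on_def)
    then have "monom 1 i + smult (- 1) (monom 1 j) \<noteq> (0::complex poly)"
      by (auto simp: poly_eq_iff intro!: exI[of _ i])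
    moreover have "poly_act T x (monom 1 i + smult (- 1) (monom 1 j)) = 0"
      using \<open>w i = w j\<close> assms by (simp only: poly_act_add poly_act_smult w_def) (simp add: vec_eq_iff)
    ultimately show ?thesis by blast
  next
    case True
    then have "card (w ` {..N}) = N + 1" by (simp add: card_image)
    then have "dependent (w ` {..N})"
      by (intro dependent_biggerset) (simp add: N_def)
    then obtain u v where u: "(\<Sum>y\<in>w ` {..N}. u y *\<^sub>R y) = 0" "v \<in> w ` {..N}" "u v \<noteq> 0"
      by (auto simp: dependent_finite)
    then obtain k where k: "k \<le> N" "v = w k" by auto
    define p where "p = (\<Sum>i\<le>N. smult (of_real (u (w i))) (monom (1::complex) i))"
    have "coeff p k = of_real (u (w k))"
      using k by (simp add: p_def coeff_sum if_distrib cong: if_cong)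
    then have "p \<noteq> 0" using u k by auto
    moreover have "poly_act T x p = (\<Sum>i\<le>N. u (w i) *\<^sub>R w i)"
      using assms by (simp only: p_def poly_act_sum poly_act_smult w_def scaleR_eq_vector_scalar_mult)
    then have "poly_act T x p = 0"
      using u(1) True by (simp add: sum.reindex)
    ultimately show ?thesis by blast
  qed
qed

text \<open>Split a root \<open>z\<close> off an annihilating polynomial, leaving \<open>q\<close>.
  Either \<open>q(T) x\<close> is an eigenvector for \<open>z\<close>, or \<open>q\<close>
  annihilates \<open>x\<close> too and has smaller degree. A nonzero constant cannot annihilate
  \<open>x\<close>.\<close>

lemma ex_eigenvector:
  assumes "x \<in> E" "x \<noteq> 0"
  shows "\<exists>v\<in>E. v \<noteq> 0 \<and> (\<exists>c. T v = c *s v)"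
proof -
  have "\<exists>v\<in>E. v \<noteq> 0 \<and> (\<exists>c. T v = c *s v)" if "p \<noteq> 0" "poly_act T x p = 0" for p
    using that
  proof (induction "degree p" arbitrary: p rule: less_induct)
    case less
    show ?case
    proof (cases "degree p = 0")
      case True
      then obtain a where "p = [:a:]" by (metis degree_eq_zeroE)
      then show ?thesis
        using less.prems assms(2) by (simp add: lin linear_0)
    next
      case False
      then obtain z where "poly p z = 0"
        using fundamental_theorem_of_algebra[of p] by (auto simp: constant_degree)
      then obtain q where q: "p = [:- z, 1:] * q" by (metis dvdE poly_eq_0_iff_dvd)
      have "q \<noteq> 0" using less.prems q by auto
      then have dq: "degree q < degree p"
        unfolding q by (subst degree_mult_eq) auto
      have "p = smult (- z) q + pCons 0 q" using q by simp
      then have "poly_act T x p = (- z) *s poly_act T x q + T (poly_act T x q)"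
        using assms by (simp only: poly_act_add poly_act_smult poly_act_pCons[OF lin]) simp
      then have "T (poly_act T x q) = z *s poly_act T x q"
        using less.prems(2) by (simp add: vec_eq_iff add_eq_0_iff)
      then show ?thesis
        using less.hyps[OF dq \<open>q \<noteq> 0\<close>] poly_act_mem[OF assms(1)] by metis
    qed
  qed
  then show ?thesis using ex_annihilating_poly[OF assms(1)] by blast
qed

end

text \<open>If some \<open>T\<close> in \<open>F\<close> is not a scalar on \<open>E\<close>, an
  eigenspace of \<open>T\<close> in \<open>E\<close> is proper and nonzero, and it is stable under
  all of \<open>F\<close> by commutation; so the dimension of \<open>E\<close> can be
  lowered.\<close>

lemma ex_common_eigenvector:
  fixes F :: "(complex^'n \<Rightarrow> complex^'n) set"
  assumes "\<And>T. T \<in> F \<Longrightarrow> complex_operator T E"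
    and "\<And>S T u. S \<in> F \<Longrightarrow> T \<in> F \<Longrightarrow> u \<in> E \<Longrightarrow> S (T u) = T (S u)"
    and "E \<noteq> {0}" "subspace E" "\<And>u. u \<in> E \<Longrightarrow> \<i> *s u \<in> E"
  shows "\<exists>v\<in>E. v \<noteq> 0 \<and> (\<forall>T\<in>F. \<exists>c. T v = c *s v)"
  using assms
proof (induction "dim E" arbitrary: E rule: less_induct)
  case less
  obtain x where x: "x \<in> E" "x \<noteq> 0"
    using less.prems(3) subspace_0[OF less.prems(4)] by blast
  show ?case
  proof (cases "\<forall>T\<in>F. \<exists>c. \<forall>u\<in>E. T u = c *s u")
    case True
    then show ?thesis using x by metis
  next
    case False
    then obtain T where T: "T \<in> F" "\<And>c. \<exists>u\<in>E. T u \<noteq> c *s u" by metis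
    interpret T: complex_operator T E using less.prems(1) T(1) .
    obtain v c where v: "v \<in> E" "v \<noteq> 0" "T v = c *s v"
      using T.ex_eigenvector[OF x] by blast
    define E' where "E' = {u \<in> E. T u = c *s u}"
    have "linear (\<lambda>u. T u - c *s u)"
      by (intro linear_compose_sub T.lin linear_vector_scalar_mult_complex)
    then have "subspace {u. T u - c *s u = 0}"
      by (rule linear_subspace_kernel)
    moreover have E'eq: "E' = E \<inter> {u. T u - c *s u = 0}" by (auto simp: E'_def)
    ultimately have sub: "subspace E'" using T.E by (simp add: subspace_inter)
    have "E' \<subset> E" using T(2)[of c] by (auto simp: E'_def)
    then have d: "dim E' < dim E"
      using sub T.E by (metis dim_psubset span_eq_iff)
    have i': "\<i> *s u \<in> E'" if "u \<in> E'" for u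
      using that by (simp add: E'_def T.iE T.Ti vector_smult_assoc mult.commute)
    have op: "complex_operator S E'" if "S \<in> F" for S
    proof -
      interpret S: complex_operator S E using less.prems(1) that .
      show ?thesis
      proof
        show "S u \<in> E'" if u: "u \<in> E'" for u
        proof -
          have "T (S u) = S (T u)"
            using less.prems(2)[OF T(1) \<open>S \<in> F\<close>] u by (simp add: E'_def)
          then show ?thesis using u by (simp add: E'_def S.TE S.T_scalar_mult)
        qed
      qed (use sub i' in \<open>auto simp: S.Ti E'_def linear_add[OF S.lin] linear_scale[OF S.lin]\<close>)
    qed
    have "\<exists>v\<in>E'. v \<noteq> 0 \<and> (\<forall>T\<in>F. \<exists>c. T v = c *s v)"
    proof (rule less.hyps[OF d op])
      show "E' \<noteq> {0}" using v by (auto simp: E'_def)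
      show "S (T u) = T (S u)" if "S \<in> F" "T \<in> F" "u \<in> E'" for S T u
        using less.prems(2) that by (simp add: E'_def)
    qed (use sub i' in auto)
    then show ?thesis by (auto simp: E'_def)
  qed
qed

section \<open>Flat hermitian forms\<close>

text \<open>Flatness says that the curvature-like expression formed from \<open>h\<close> with
  \<open>cform\<close> vanishes, as in the Gauss equation of a flat space.\<close>

locale flat_hermitian_form =
  fixes h :: "'v::euclidean_space \<Rightarrow> 'v \<Rightarrow> complex^'n" and J :: "'v \<Rightarrow> 'v"
  assumes bilinear: "bilinear h"
    and J_left: "h (J X) Y = \<i> *s h X Y"
    and hermitian: "h Y X = cconj (h X Y)"
    and flat: "cform (h X A) (h Y B) = cform (h Y A) (h X B)"
begin

lemmas h_simps = bilinear_ladd[OF bilinear] bilinear_radd[OF bilinear]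
  bilinear_lmul[OF bilinear] bilinear_rmul[OF bilinear]

lemma linear_left: "linear (\<lambda>Z. h Z A)"
  using bilinear by (simp add: bilinear_def)

definition "nullity_space = {Z. \<forall>A. h Z A = 0}"

text \<open>Imaginary parts give nothing new: the imaginary part of \<open>h X Y\<close> is minus
  the real part of \<open>h (J X) Y\<close>.\<close>

definition "value_space = span {vRe (h X Y) | X Y. True}"

text \<open>Flatness trades the pair \<open>h Z Z\<close>, \<open>h W W\<close> for the pair
  \<open>h W Z\<close>, \<open>h Z W\<close>, which are conjugate, so their \<open>cform\<close> is
  a squared norm.\<close>

lemma null_diagonal:
  assumes "h Z Z = 0"
  shows "Z \<in> nullity_space"
proof -
  have "cform (cconj (h Z W)) (h Z W) = 0" for W
    using flat[of W Z Z W] assms by (simp add: hermitian[of W Z, symmetric] cform_simps)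
  then show ?thesis by (simp add: nullity_space_def cform_cconj_eq_0)
qed

lemma subspace_nullity_space: "subspace nullity_space"
  by (auto simp: nullity_space_def subspace_def h_simps bilinear_lzero[OF bilinear])

lemma value_in_complexify: "h X Y \<in> complexify value_space"
proof -
  have "vIm (h X Y) = - vRe (h (J X) Y)"
    by (simp add: J_left vIm_def vRe_def vec_eq_iff)
  moreover have "vRe (h A B) \<in> value_space" for A B
    unfolding value_space_def by (rule span_base) auto
  ultimately show ?thesis
    by (simp add: complexify_def value_space_def span_neg)
qed

text \<open>If \<open>h Z A = 0\<close> with \<open>Z\<close> not in the nullity, then \<open>h Z Z\<close> is real and orthogonal to the image of
  \<open>h(\<cdot>, A)\<close>, so replacing \<open>A\<close> by \<open>A + t Z\<close> with small \<open>t\<close> increases the rank.\<close>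

lemma kernel_not_minimal:
  assumes "h Z A = 0" "Z \<notin> nullity_space"
  shows "\<exists>A'. dim {W. h W A' = 0} < dim {W. h W A = 0}"
proof -
  define v where "v = h Z Z"
  define q where "q = cform v v"
  have "v \<noteq> 0" using null_diagonal assms(2) by (auto simp: v_def)
  moreover have "cconj v = v" by (simp add: v_def hermitian[symmetric])
  ultimately have q0: "q \<noteq> 0" using cform_cconj_eq_0[of v] by (simp add: q_def)
  have perp: "cform (h W A) v = 0" for W
    using flat[of W A Z Z] assms(1) by (simp add: v_def cform_simps)
  \<comment> \<open>The projection along \<open>v\<close> onto its \<open>cform\<close>-complement,
    available because \<open>q\<close> is nonzero. It kills \<open>v\<close> and fixes the image of
    \<open>h(., A)\<close>.\<close>
  define \<pi> where "\<pi> u = u - (cform u v / q) *s v" for u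
  have lin\<pi>: "linear \<pi>"
    by (rule linearI)
       (simp_all add: \<pi>_def cform_simps scaleR_eq_vector_scalar_mult vec_eq_iff algebra_simps add_divide_distrib)
  have \<pi>v: "\<pi> v = 0" using q0 by (simp add: \<pi>_def q_def vec_eq_iff)
  have \<pi>A: "\<pi> (h W A) = h W A" for W by (simp add: \<pi>_def perp)
  let ?N = "{W. h W A = 0}"
  define K where "K = {W. \<forall>k\<in>?N. orthogonal k W}"
  have N: "subspace ?N" by (rule linear_subspace_kernel[OF linear_left])
  have K: "subspace K" unfolding K_def by (rule subspace_orthogonal_to_vectors)
  have dimK: "dim K + dim ?N = DIM('v)"
    using dim_subspace_orthogonal_to_vectors[OF N subspace_UNIV] by (simp add: K_def)
  \<comment> \<open>On the orthogonal complement \<open>K\<close> of the kernel,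
    \<open>h(., A)\<close> is injective, hence bounded below by a positive \<open>e\<close>.\<close>
  have "\<forall>W\<in>K. h W A = 0 \<longrightarrow> W = 0" by (auto simp: K_def orthogonal_self)
  then obtain e where e: "e > 0" "\<And>W. W \<in> K \<Longrightarrow> norm (h W A) \<ge> e * norm W"
    using injective_imp_isometric[OF closed_subspace[OF K] K linear_conv_bounded_linear[THEN iffD1, OF linear_left]]
    by metis
  have "bounded_linear (\<lambda>W. \<pi> (h W Z))"
    using linear_compose[OF linear_left[of Z] lin\<pi>] by (simp add: linear_conv_bounded_linear o_def)
  then obtain M where M: "M > 0" "\<And>W. norm (\<pi> (h W Z)) \<le> norm W * M"
    using bounded_linear.pos_bounded by blast
  \<comment> \<open>Chosen so that the perturbation \<open>t *\<^sub>R \<pi> (h W Z)\<close> has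
    norm at most half of the lower bound \<open>e * norm W\<close>.\<close>
  define t where "t = e / (2 * M)"
  have t: "t > 0" "t * M < e" using e M by (auto simp: t_def field_simps)
  \<comment> \<open>Since \<open>h Z A = 0\<close>, only a multiple of \<open>v\<close> is
    contributed by \<open>c\<close>. Applying \<pi> removes it, and the estimate gives
    \<open>W = 0\<close>; what remains is \<open>c * t\<close> times \<open>v\<close>, so
    \<open>c = 0\<close>.\<close>
  have inj: "W + c *\<^sub>R Z = 0" if "W \<in> K" "h (W + c *\<^sub>R Z) (A + t *\<^sub>R Z) = 0" for W c
  proof -
    have eq: "h W A + t *\<^sub>R h W Z + (c * t) *\<^sub>R v = 0"
      using that(2) assms(1) by (simp add: h_simps v_def algebra_simps)
    then have "\<pi> (h W A + t *\<^sub>R h W Z + (c * t) *\<^sub>R v) = 0"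
      by (simp add: linear_0[OF lin\<pi>])
    then have "h W A = - (t *\<^sub>R \<pi> (h W Z))"
      by (simp add: linear_add[OF lin\<pi>] linear_scale[OF lin\<pi>] \<pi>v \<pi>A add_eq_0_iff2)
    then have "norm (h W A) = t * norm (\<pi> (h W Z))"
      using t by simp
    then have "e * norm W \<le> t * (norm W * M)"
      using e(2)[OF that(1)] M(2)[of W] t by (smt (verit) mult_left_mono)
    then have "(e - t * M) * norm W \<le> 0" by (simp add: algebra_simps)
    then have "W = 0" using t(2) by (simp add: mult_le_0_iff)
    then show ?thesis using eq t \<open>v \<noteq> 0\<close> bilinear_lzero[OF bilinear] by simp
  qed
  have "Z \<notin> K"
  proof
    assume "Z \<in> K"
    then have "Z = 0" using assms(1) by (auto simp: K_def orthogonal_self)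
    then show False using assms(2) subspace_0[OF subspace_nullity_space] by simp
  qed
  then have dS: "dim (insert Z K) = dim K + 1"
    using K by (simp add: dim_insert span_eq_iff[THEN iffD2])
  let ?N' = "{W. h W (A + t *\<^sub>R Z) = 0}"
  have N': "subspace ?N'" by (rule linear_subspace_kernel[OF linear_left])
  \<comment> \<open>A space one dimension larger than \<open>K\<close> meets the new kernel
    trivially, so the new kernel is smaller than the old one.\<close>
  have "span (insert Z K) \<inter> ?N' \<subseteq> {0}"
  proof
    fix W assume W: "W \<in> span (insert Z K) \<inter> ?N'"
    then obtain c where "W - c *\<^sub>R Z \<in> K"
      using K by (auto simp: span_insert span_eq_iff[THEN iffD2])
    then show "W \<in> {0}" using inj[of "W - c *\<^sub>R Z" c] W by simp
  qed
  then have "dim (span (insert Z K) \<inter> ?N') = 0"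
    by (metis dim_eq_0)
  then have "dim (insert Z K) + dim ?N' \<le> DIM('v)"
    using dim_sums_Int[OF subspace_span N', of "insert Z K"]
      dim_subset_UNIV[of "{x + y |x y. x \<in> span (insert Z K) \<and> y \<in> ?N'}"]
    by (simp del: dim_eq_0)
  then show ?thesis using dS dimK by (intro exI[of _ "A + t *\<^sub>R Z"]) simp
qed

text \<open>Take \<open>A\<close> with kernel of least dimension; by
  \<open>kernel_not_minimal\<close> no kernel vector lies outside the nullity.\<close>

lemma ex_regular: "\<exists>A. {Z. h Z A = 0} = nullity_space"
proof -
  obtain A where A: "\<And>B. dim {W. h W A = 0} \<le> dim {W. h W B = 0}"
    using ex_has_least_nat[of "\<lambda>_. True" 0 "\<lambda>A. dim {W. h W A = 0}"] by auto
  then have "{Z. h Z A = 0} \<subseteq> nullity_space"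
    using kernel_not_minimal[of _ A] by (auto simp: linorder_not_less[symmetric])
  then show ?thesis by (auto simp: nullity_space_def)
qed

text \<open>For regular \<open>A\<close> the rank of \<open>h(., A)\<close> is complementary to the
  nullity and at most the real dimension of the complexified value space.\<close>

lemma dim_nullity_space: "DIM('v) \<le> dim nullity_space + 2 * dim value_space"
proof -
  obtain A where "{Z. h Z A = 0} = nullity_space" using ex_regular ..
  then have "dim (range (\<lambda>Z. h Z A)) + dim nullity_space = DIM('v)"
    using dim_range_plus_dim_kernel[OF linear_left[of A]] by simp
  moreover have "dim (range (\<lambda>Z. h Z A)) \<le> dim (complexify value_space)"
    using value_in_complexify by (intro dim_subset) auto
  ultimately show ?thesis
    by (simp add: dim_complexify value_space_def)
qed

text \<open>When \<open>h(\<cdot>, A)\<close> maps onto the complexified value space, the maps \<open>h(\<cdot>, B)\<close> composed with its inverse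
  are symmetric for \<open>cform\<close> and commute; a common eigenvector gives a vector \<open>e\<close> for which \<open>h(e, \<cdot>)\<close> has
  rank one.\<close>

lemma ex_rank_one:
  assumes A: "{Z. h Z A = 0} = nullity_space"
    and onto: "range (\<lambda>Z. h Z A) = complexify value_space"
    and "value_space \<noteq> {0}"
  shows "\<exists>e. e \<notin> nullity_space \<and> (\<forall>B. \<exists>c. h e B = c *s h e e)"
proof -
  let ?E = "complexify value_space"
  have L: "subspace value_space" by (simp add: value_space_def)
  obtain s where s: "linear s" "\<And>u. u \<in> ?E \<Longrightarrow> h (s u) A = u"
    using linear_exists_right_inverse_on[OF linear_left[of A] subspace_UNIV]
    by (auto simp: onto)
  define C where "C B u = h (s u) B" for B u
  \<comment> \<open>The choice of \<open>s\<close> does not matter: two preimages under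
    \<open>h(., A)\<close> differ by a nullity vector, which \<open>h(., B)\<close> kills.\<close>
  have CA: "C B (h Z A) = h Z B" for B Z
  proof -
    have "h (s (h Z A) - Z) A = 0"
      using s(2)[of "h Z A"] onto by (auto simp: bilinear_lsub[OF bilinear])
    then have "s (h Z A) - Z \<in> nullity_space" using A by blast
    then show ?thesis by (simp add: C_def nullity_space_def bilinear_lsub[OF bilinear])
  qed
  have pre: "\<exists>Z. u = h Z A" if "u \<in> ?E" for u
    using that by (auto simp: onto[symmetric])
  have mem: "C B u \<in> ?E" for B u by (simp add: C_def value_in_complexify)
  have op: "complex_operator (C B) ?E" for B
  proof
    show "C B (x + y) = C B x + C B y" for x y
      by (simp add: C_def linear_add[OF s(1)] h_simps)
    show "C B (r *\<^sub>R x) = r *\<^sub>R C B x" for x r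
      by (simp add: C_def linear_scale[OF s(1)] h_simps)
    show "C B (\<i> *s u) = \<i> *s C B u" if u: "u \<in> ?E" for u
    proof -
      obtain Z where "u = h Z A" using pre[OF u] ..
      then show ?thesis using CA[of B "J Z"] CA[of B Z] by (simp add: J_left)
    qed
  qed (use L mem in \<open>auto simp: subspace_complexify complexify_imaginary\<close>)
  have sym: "cform (C B u) w = cform u (C B w)" if uw: "u \<in> ?E" "w \<in> ?E" for B u w
  proof -
    obtain Z W where "u = h Z A" "w = h W A" using pre uw by metis
    then show ?thesis using flat[of Z B W A] by (simp add: CA cform_commute)
  qed
  have com: "C B (C B' u) = C B' (C B u)" if u: "u \<in> ?E" for B B' u
  proof -
    let ?d = "C B (C B' u) - C B' (C B u)"
    \<comment> \<open>By symmetry and flatness the commutator is \<open>cform\<close>-orthogonal to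
      all of \<open>?E\<close>. As \<open>?E\<close> is closed under conjugation, this includes its
      own conjugate, so it vanishes.\<close>
    have "cform ?d w = 0" if w: "w \<in> ?E" for w
    proof -
      obtain Z W where zw: "u = h Z A" "w = h W A" using pre u w by metis
      have "cform ?d w = cform (C B' u) (C B w) - cform (C B u) (C B' w)"
        using mem w by (simp add: cform_simps sym)
      also have "\<dots> = 0"
        using flat[of Z B' W B] by (simp add: zw CA cform_commute)
      finally show ?thesis .
    qed
    moreover have "cconj ?d \<in> ?E"
      using L mem by (intro complexify_cconj subspace_diff subspace_complexify) auto
    ultimately have "cform ?d (cconj ?d) = 0" by blast
    then have "?d = 0"
      by (simp only: cform_commute[of ?d] cform_cconj_eq_0)
    then show ?thesis by simp
  qed
  have "?E \<noteq> {0}"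
  proof -
    obtain p where "p \<in> value_space" "p \<noteq> 0" using assms(3) subspace_0[OF L] by auto
    then have "cplx p 0 \<in> ?E" "cplx p 0 \<noteq> 0"
      by (auto simp: complexify_def subspace_0[OF L] cplx_eq_0_iff)
    then show ?thesis by blast
  qed
  then obtain v where v: "v \<in> ?E" "v \<noteq> 0" "\<And>B. \<exists>c. C B v = c *s v"
    using ex_common_eigenvector[of "range C" ?E] op com subspace_complexify[OF L]
      complexify_imaginary[OF L]
    by blast
  then obtain e where e: "v = h e A" using pre by blast
  have ev: "\<exists>c. h e B = c *s v" for B using v(3)[of B] CA by (simp add: e)
  have "e \<notin> nullity_space" using e v(2) by (auto simp: nullity_space_def)
  \<comment> \<open>To replace \<open>v\<close> by \<open>h e e\<close> as generator of the image,
    \<open>h e e\<close> must be nonzero; this is \<open>null_diagonal\<close>.\<close>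
  moreover obtain c where c: "h e e = c *s v" using ev by blast
  ultimately have "c \<noteq> 0" using null_diagonal by fastforce
  then have "v = (1 / c) *s h e e" by (simp add: c vec_eq_iff)
  then show ?thesis using ev \<open>e \<notin> nullity_space\<close> by (metis vector_smult_assoc)
qed

text \<open>The image of a regular \<open>h(., A)\<close> is either the whole complexified value
  space, which gives rank one, or a proper complex subspace of it, which costs two real
  dimensions.\<close>

lemma nullity_gap_or_rank_one:
  assumes "value_space \<noteq> {0}"
  shows "DIM('v) + 2 \<le> dim nullity_space + 2 * dim value_space \<or>
    (\<exists>e. e \<notin> nullity_space \<and> (\<forall>B. \<exists>c. h e B = c *s h e e))"
proof -
  obtain A where A: "{Z. h Z A = 0} = nullity_space" using ex_regular ..
  then have r: "dim (range (\<lambda>Z. h Z A)) + dim nullity_space = DIM('v)"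
    using dim_range_plus_dim_kernel[OF linear_left[of A]] by simp
  have L: "subspace value_space" by (simp add: value_space_def)
  show ?thesis
  proof (cases "range (\<lambda>Z. h Z A) = complexify value_space")
    case True
    then show ?thesis using ex_rank_one[OF A _ assms] by blast
  next
    case False
    have "range (\<lambda>Z. h Z A) \<subset> complexify value_space"
      using False value_in_complexify by auto
    then have "dim (range (\<lambda>Z. h Z A)) + 2 \<le> dim (complexify value_space)"
    proof (rule dim_proper_complex_subspace[rotated 2])
      show "\<i> *s u \<in> range (\<lambda>Z. h Z A)" if "u \<in> range (\<lambda>Z. h Z A)" for u
        using that by (auto simp: J_left[symmetric])
    qed (auto simp: L subspace_complexify complexify_imaginary linear_subspace_image[OF linear_left])
    then show ?thesis using r L by (simp add: dim_complexify)
  qed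
qed

end

section \<open>Second fundamental forms of Kaehler type\<close>

text \<open>With the curvature \<open>R\<close> given by the Gauss equation,
  \<open>curvature_J\<close> is the Kaehler symmetry
  \<open>R(X, Y, J Z, J W) = R(X, Y, Z, W)\<close>.\<close>

locale kaehler_form =
  fixes \<alpha> :: "'v::euclidean_space \<Rightarrow> 'v \<Rightarrow> real^'n" and J :: "'v \<Rightarrow> 'v"
  assumes bil: "bilinear \<alpha>" and sym: "\<alpha> X Y = \<alpha> Y X"
    and linJ: "linear J" and JJ: "J (J X) = - X"
    and curvature_J: "\<alpha> X W \<bullet> \<alpha> Y Z - \<alpha> X Z \<bullet> \<alpha> Y W =
      \<alpha> X (J W) \<bullet> \<alpha> Y (J Z) - \<alpha> X (J Z) \<bullet> \<alpha> Y (J W)"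
begin

lemmas \<alpha>_simps = bilinear_ladd[OF bil] bilinear_radd[OF bil] bilinear_lmul[OF bil]
  bilinear_rmul[OF bil] bilinear_lneg[OF bil] bilinear_rneg[OF bil]

lemmas J_simps = linear_add[OF linJ] linear_scale[OF linJ] linear_neg[OF linJ] JJ

definition herm :: "'v \<Rightarrow> 'v \<Rightarrow> complex^'n" where
  "herm X Y = cplx (\<alpha> X Y + \<alpha> (J X) (J Y)) (\<alpha> X (J Y) - \<alpha> (J X) Y)"

text \<open>Complex linear in \<open>X\<close>. While \<open>herm\<close> only sees the symmetrized
  form \<open>P\<close>, this form retains all of \<alpha>, as needed for the nullities of \<alpha>
  itself.\<close>

definition holo :: "'v \<Rightarrow> 'v \<Rightarrow> complex^'n" where
  "holo X Y = cplx (\<alpha> X Y) (- \<alpha> (J X) Y)"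

lemma holo_J: "holo (J X) Y = \<i> *s holo X Y"
  by (simp add: holo_def imaginary_cplx J_simps \<alpha>_simps)

lemma herm_J: "herm (J X) Y = \<i> *s herm X Y"
  by (simp add: herm_def imaginary_cplx J_simps \<alpha>_simps add.commute)

lemma herm_eq_holo: "herm X Y = holo X Y + holo (J X) (J Y)"
  by (simp add: herm_def holo_def cplx_add J_simps \<alpha>_simps)

text \<open>The sum of two instances of \<open>curvature_J\<close>, the second having
  \<open>J X\<close> and \<open>J Y\<close> in place of \<open>X\<close> and \<open>Y\<close>,
  regrouped.\<close>

lemma flat_Re: "Re (cform (herm Y X) (holo W Z)) = Re (cform (herm W X) (holo Y Z))"
proof -
  have "\<alpha> Y X = \<alpha> X Y" "\<alpha> W X = \<alpha> X W" "\<alpha> (J Y) X = \<alpha> X (J Y)" "\<alpha> (J W) X = \<alpha> X (J W)"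
    "\<alpha> Y (J X) = \<alpha> (J X) Y" "\<alpha> W (J X) = \<alpha> (J X) W" "\<alpha> Y Z = \<alpha> Z Y" "\<alpha> W Z = \<alpha> Z W"
    "\<alpha> (J Y) Z = \<alpha> Z (J Y)" "\<alpha> (J W) Z = \<alpha> Z (J W)"
    "\<alpha> (J Y) (J X) = \<alpha> (J X) (J Y)" "\<alpha> (J W) (J X) = \<alpha> (J X) (J W)"
    by (rule sym)+
  then show ?thesis
    using curvature_J[of X Y Z W] curvature_J[of "J X" "J Y" Z W]
    by (simp add: herm_def holo_def cform_cplx inner_simps JJ \<alpha>_simps)
qed

text \<open>Both sides are complex linear in \<open>Y\<close>, so the imaginary part follows from
  the real part at \<open>J Y\<close>.\<close>

lemma flat_holo: "cform (herm Y X) (holo W Z) = cform (herm W X) (holo Y Z)"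
proof (rule complex_eqI[OF flat_Re])
  have "Re (cform (herm (J Y) X) (holo W Z)) = Re (cform (herm W X) (holo (J Y) Z))"
    by (rule flat_Re)
  then show "Im (cform (herm Y X) (holo W Z)) = Im (cform (herm W X) (holo Y Z))"
    by (simp add: herm_J holo_J cform_simps)
qed

sublocale flat_hermitian_form herm J
proof
  show "bilinear herm"
    unfolding bilinear_def
    by (auto intro!: linearI simp: herm_def cplx_add cplx_scaleR J_simps \<alpha>_simps algebra_simps)
  show "herm Y X = cconj (herm X Y)" for X Y
    by (simp add: herm_def cconj_cplx sym[of Y] sym[of "J Y"])
  \<comment> \<open>The second factor \<open>herm Y B\<close> is \<open>holo Y B\<close> plus \<i>
    times \<open>holo Y (J B)\<close>, and \<open>flat_holo\<close> applies to both terms.\<close>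
  show "cform (herm X A) (herm Y B) = cform (herm Y A) (herm X B)" for X A Y B
    using flat_holo[of X A Y B] flat_holo[of X A Y "J B"]
    by (simp add: herm_eq_holo[of Y B] herm_eq_holo[of X B] holo_J cform_simps)
qed (rule herm_J)

text \<open>Pairing with the vectors of \<open>U\<close> replaces the projection to
  \<open>U\<close>; \<open>complex_null_space_eq\<close> identifies the two versions for
  subspaces.\<close>

definition complex_null :: "(real^'n) set \<Rightarrow> 'v set" where
  "complex_null U = {v. \<forall>u. \<forall>\<xi>\<in>U. \<xi> \<bullet> \<alpha> u v = 0 \<and> \<xi> \<bullet> \<alpha> u (J v) = 0}"

lemma complex_null_holo:
  assumes "\<And>\<xi> B. \<xi> \<in> U \<Longrightarrow> cform (cplx \<xi> 0) (holo Z B) = 0"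
  shows "Z \<in> complex_null U"
proof -
  have "\<xi> \<bullet> \<alpha> B Z = 0 \<and> \<xi> \<bullet> \<alpha> B (J Z) = 0" if "\<xi> \<in> U" for \<xi> B
    using assms[OF that, of B]
    by (simp add: holo_def cform_cplx complex_eq_iff inner_simps sym[of B])
  then show ?thesis by (auto simp: complex_null_def)
qed

lemma complex_null_J: "Z \<in> complex_null U \<Longrightarrow> J Z \<in> complex_null U"
  by (auto simp: complex_null_def J_simps \<alpha>_simps inner_simps)

text \<open>\<open>flat_holo\<close> moves \<open>Z\<close> from \<open>holo\<close> into
  \<open>herm\<close>, where it gives zero. So \<open>holo Z B\<close> is
  \<open>cform\<close>-orthogonal to all values of \<open>herm\<close>, hence to their real parts.
  This passes from the nullity of \<open>P\<close> to that of the component of \<alpha> in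
  \<open>L\<close>.\<close>

lemma nullity_subset: "nullity_space \<subseteq> complex_null value_space"
proof
  fix Z assume "Z \<in> nullity_space"
  then have 0: "cform (herm X Y) (holo Z B) = 0" for X Y B
    using flat_holo[of X Y Z B] by (simp add: nullity_space_def cform_simps)
  show "Z \<in> complex_null value_space"
  proof (rule complex_null_holo)
    fix \<xi> B assume "\<xi> \<in> value_space"
    then show "cform (cplx \<xi> 0) (holo Z B) = 0"
      unfolding value_space_def
    proof (induction rule: span_induct_alt)
      case base
      then show ?case by (simp add: cplx_eq_0_iff[THEN iffD2] cform_simps)
    next
      case (step c x y)
      then obtain X Y where x: "x = vRe (herm X Y)" by auto
      have "cplx x 0 = (1/2) *s herm X Y + (1/2) *s herm Y X"
        by (simp add: x vRe_eq_cconj hermitian[symmetric] scaleR_eq_vector_scalar_mult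
            vector_add_ldistrib)
      then have "cform (cplx x 0) (holo Z B) = 0" by (simp add: cform_simps 0)
      moreover have "cplx (c *\<^sub>R x + y) 0 = of_real c *s cplx x 0 + cplx y 0"
        by (simp add: scaleR_eq_vector_scalar_mult[symmetric] cplx_scaleR cplx_add)
      ultimately show ?case using step by (simp add: cform_simps)
    qed
  qed
qed

text \<open>When \<open>herm e\<close> has rank one, pairing a value \<open>herm X Y\<close> with
  \<open>holo e B\<close> or with \<xi> gives the same factor \<open>r Y X\<close> times the
  corresponding pairing of \<xi>. So on the value space the functional of \<open>holo e B\<close> is
  proportional to that of \<xi>, and it vanishes where the latter does.\<close>

lemma rank_one_null:
  assumes e: "\<And>B. \<exists>c. herm e B = c *s herm e e"
  defines "\<xi> \<equiv> vRe (herm e e)"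
  shows "e \<in> complex_null (value_space \<inter> {w. w \<bullet> \<xi> = 0})"
proof -
  obtain l where l: "\<And>B. herm e B = l B *s herm e e" using e by metis
  have \<xi>: "herm e e = cplx \<xi> 0"
    by (simp add: \<xi>_def herm_def sym)
  show ?thesis
  proof (cases "\<xi> = 0")
    case True
    then have "e \<in> nullity_space"
      by (intro null_diagonal) (simp add: \<xi> cplx_eq_0_iff)
    then show ?thesis
      using nullity_subset by (auto simp: complex_null_def)
  next
    case False
    define r where "r Y X = l Y * cnj (l X)" for Y X
    have l': "herm X e = cnj (l X) *s herm e e" for X
      using hermitian[of X e] hermitian[of e e]
      by (simp add: l[of X] cconj_def vec_eq_iff)
    have key: "cform (herm X Y) (holo e B) = r Y X * cform (cplx \<xi> 0) (holo e B)" for X Y B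
    proof -
      have "cform (herm X Y) (holo e B) = l Y * cform (herm e e) (holo X B)"
        by (subst flat_holo, subst l) (simp add: cform_simps)
      also have "\<dots> = l Y * cform (herm X e) (holo e B)"
        by (subst flat_holo) simp
      also have "\<dots> = r Y X * cform (cplx \<xi> 0) (holo e B)"
        by (subst l') (simp add: cform_simps r_def \<xi>)
      finally show ?thesis .
    qed
    have herm_holo: "cform (herm X Y) (cplx \<xi> 0) = r Y X * cform (cplx \<xi> 0) (cplx \<xi> 0)" for X Y
      using flat[of X Y e e] l'[of X] l[of Y] by (simp add: \<xi>[symmetric] r_def cform_simps)
    \<comment> \<open>The proportionality is written without division, so that both sides are linear
      in \<open>w\<close> and induction over the span applies.\<close>
    have "cform (cplx w 0) (holo e B) * cform (cplx \<xi> 0) (cplx \<xi> 0)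
        = cform (cplx w 0) (cplx \<xi> 0) * cform (cplx \<xi> 0) (holo e B)"
      if "w \<in> value_space" for w B
      using that unfolding value_space_def
    proof (induction rule: span_induct_alt)
      case base
      then show ?case by (simp add: cplx_eq_0_iff[THEN iffD2] cform_simps)
    next
      case (step c x y)
      then obtain X Y where x: "x = vRe (herm X Y)" by auto
      have "cplx x 0 = (1/2) *s herm X Y + (1/2) *s herm Y X"
        by (simp add: x vRe_eq_cconj hermitian[symmetric] scaleR_eq_vector_scalar_mult
            vector_add_ldistrib)
      then have "cform (cplx x 0) (holo e B) * cform (cplx \<xi> 0) (cplx \<xi> 0)
        = cform (cplx x 0) (cplx \<xi> 0) * cform (cplx \<xi> 0) (holo e B)"
        by (simp add: cform_simps key herm_holo algebra_simps)
      moreover have "cplx (c *\<^sub>R x + y) 0 = of_real c *s cplx x 0 + cplx y 0"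
        by (simp add: scaleR_eq_vector_scalar_mult[symmetric] cplx_scaleR cplx_add)
      ultimately show ?case using step by (simp add: cform_simps algebra_simps)
    qed
    moreover have "cform (cplx \<xi> 0) (cplx \<xi> 0) \<noteq> 0"
      using False by (simp add: cform_cplx complex_eq_iff)
    moreover have "cform (cplx w 0) (cplx \<xi> 0) = 0" if "w \<bullet> \<xi> = 0" for w
      using that by (simp add: cform_cplx complex_eq_iff)
    ultimately show ?thesis
      by (intro complex_null_holo) (metis IntE mem_Collect_eq mult_eq_0_iff mult_zero_left)
  qed
qed

text \<open>In the gap case the nullity is already large enough for any hyperplane of the value
  space. In the rank-one case the hyperplane orthogonal to \<open>herm e e\<close> gains
  \<open>e\<close> and \<open>J e\<close>.\<close>

lemma ex_large_complex_null:
  assumes "value_space \<noteq> {0}" "dim value_space \<noteq> 1"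
  shows "\<exists>U. subspace U \<and> U \<subseteq> value_space \<and> dim U + 1 = dim value_space \<and>
    DIM('v) \<le> dim (complex_null U) + 2 * dim U"
proof -
  have L: "subspace value_space" by (simp add: value_space_def)
  have hyper: "subspace (value_space \<inter> {w. w \<bullet> \<xi> = 0}) \<and>
      dim (value_space \<inter> {w. w \<bullet> \<xi> = 0}) + 1 = dim value_space"
    if "\<xi> \<in> value_space" "\<xi> \<noteq> 0" for \<xi>
  proof -
    have eq: "value_space \<inter> {w. w \<bullet> \<xi> = 0} = {y \<in> value_space. \<forall>x\<in>span {\<xi>}. orthogonal x y}"
      by (auto simp: span_singleton orthogonal_def inner_commute intro: exI[of _ 1])
    have "dim {y \<in> value_space. \<forall>x\<in>span {\<xi>}. orthogonal x y} + dim (span {\<xi>}) = dim value_space"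
      using that(1) L by (intro dim_subspace_orthogonal_to_vectors) (auto simp: span_minimal)
    moreover have "dim (span {\<xi>}) = 1" using that(2) by simp
    moreover have "subspace (value_space \<inter> {w. w \<bullet> \<xi> = 0})"
      using L by (simp add: subspace_inter subspace_hyperplane2)
    ultimately show ?thesis by (simp add: eq)
  qed
  have mono: "nullity_space \<subseteq> complex_null (value_space \<inter> H)" for H
    using nullity_subset by (auto simp: complex_null_def)
  from nullity_gap_or_rank_one[OF assms(1)] show ?thesis
  proof
    assume gap: "DIM('v) + 2 \<le> dim nullity_space + 2 * dim value_space"
    obtain \<xi> where "\<xi> \<in> value_space" "\<xi> \<noteq> 0" using assms(1) subspace_0[OF L] by auto
    then have *: "subspace (value_space \<inter> {w. w \<bullet> \<xi> = 0})"
        "dim (value_space \<inter> {w. w \<bullet> \<xi> = 0}) + 1 = dim value_space"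
      using hyper by auto
    have "dim nullity_space \<le> dim (complex_null (value_space \<inter> {w. w \<bullet> \<xi> = 0}))"
      by (rule dim_subset[OF mono])
    then show ?thesis
      using * gap by (intro exI[of _ "value_space \<inter> {w. w \<bullet> \<xi> = 0}"]) auto
  next
    assume "\<exists>e. e \<notin> nullity_space \<and> (\<forall>B. \<exists>c. herm e B = c *s herm e e)"
    then obtain e where e: "e \<notin> nullity_space" "\<And>B. \<exists>c. herm e B = c *s herm e e" by auto
    define \<xi> where "\<xi> = vRe (herm e e)"
    have \<xi>0: "\<xi> \<noteq> 0"
      using null_diagonal[of e] e(1) by (auto simp: \<xi>_def herm_def sym cplx_eq_0_iff)
    have "\<xi> \<in> value_space"
      unfolding value_space_def \<xi>_def by (rule span_base) auto
    let ?U = "value_space \<inter> {w. w \<bullet> \<xi> = 0}"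
    have U: "subspace ?U" "dim ?U + 1 = dim value_space"
      using hyper[OF \<open>\<xi> \<in> value_space\<close> \<xi>0] by auto
    have eU: "e \<in> complex_null ?U"
      using rank_one_null[OF e(2)] by (simp add: \<xi>_def)
    have N: "subspace nullity_space" by (rule subspace_nullity_space)
    have d1: "dim (insert e nullity_space) = dim nullity_space + 1"
      using e(1) N by (simp add: dim_insert span_eq_iff[THEN iffD2])
    \<comment> \<open>Modulo the nullity, \<open>J e\<close> being \<open>k\<close> times
      \<open>e\<close> would give \<open>(\<i> - k)\<close> times \<open>herm e e\<close> equal to
      zero, and \<i> is not real.\<close>
    have "J e \<notin> span (insert e nullity_space)"
    proof
      assume "J e \<in> span (insert e nullity_space)"
      then obtain k where "J e - k *\<^sub>R e \<in> nullity_space"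
        using N by (auto simp: span_insert span_eq_iff[THEN iffD2])
      then have "herm (J e - k *\<^sub>R e) e = 0" by (simp add: nullity_space_def)
      then have "(\<i> - of_real k) *s herm e e = 0"
        by (simp add: bilinear_lsub[OF bilinear] bilinear_lmul[OF bilinear] herm_J
            scaleR_eq_vector_scalar_mult vec_eq_iff algebra_simps)
      moreover have "\<i> - of_real k \<noteq> 0" by (simp add: complex_eq_iff)
      ultimately have "herm e e = 0" by (simp add: vec_eq_iff)
      then show False using null_diagonal e(1) by blast
    qed
    then have "dim (insert (J e) (insert e nullity_space)) = dim nullity_space + 2"
      using d1 by (simp add: dim_insert)
    moreover have "insert (J e) (insert e nullity_space) \<subseteq> complex_null ?U"
      using eU complex_null_J mono by auto
    ultimately have "dim nullity_space + 2 \<le> dim (complex_null ?U)"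
      by (metis dim_subset)
    then show ?thesis
      using U dim_nullity_space by (intro exI[of _ ?U]) auto
  qed
qed

end

section \<open>Directional derivatives\<close>

lemma frechet_derivative_eqI:
  "(f has_derivative f') (at x) \<Longrightarrow> frechet_derivative f (at x) = f'"
  using frechet_derivative_at by fastforce

text \<open>\<open>frechet_derivative\<close> is a choice among the derivatives, so functions
  agreeing near \<open>x\<close> have the same one even where they are not differentiable.\<close>

lemma frechet_derivative_cong_open:
  assumes "open S" "x \<in> S" "\<And>y. y \<in> S \<Longrightarrow> f y = g y"
  shows "frechet_derivative f (at x) = frechet_derivative g (at x)"
proof -
  have "(f has_derivative D) (at x) \<longleftrightarrow> (g has_derivative D) (at x)" for D
    using has_derivative_transform_within_open[OF _ assms(1,2)] assms(3) by metis
  then show ?thesis by (simp add: frechet_derivative_def)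
qed

lemma differentiable_cong_open:
  assumes "open S" "x \<in> S" "\<And>y. y \<in> S \<Longrightarrow> f y = g y" "f differentiable (at x)"
  shows "g differentiable (at x)"
  using assms has_derivative_transform_within_open[OF _ assms(1,2)]
  by (metis differentiable_def)

lemma C_k_on_cong:
  assumes "open S" "\<And>y. y \<in> S \<Longrightarrow> f y = g y" "C_k_on k f S"
  shows "C_k_on k g S"
  using assms(2,3)
proof (induction k arbitrary: f g)
  case 0
  then show ?case by (auto cong: continuous_on_cong)
next
  case (Suc k)
  have "g differentiable (at x)" if "x \<in> S" for x
    using differentiable_cong_open[OF assms(1) that Suc.prems(1)] Suc.prems(2) that by auto
  moreover have "C_k_on k (\<lambda>x. frechet_derivative g (at x) v) S" for v
  proof (rule Suc.IH)
    show "C_k_on k (\<lambda>x. frechet_derivative f (at x) v) S" using Suc.prems(2) by simp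
    show "frechet_derivative f (at y) v = frechet_derivative g (at y) v" if "y \<in> S" for y
      using frechet_derivative_cong_open[OF assms(1) that Suc.prems(1)] by simp
  qed
  ultimately show ?case by simp
qed

lemma C_k_on_SucD: "C_k_on (Suc k) f S \<Longrightarrow> C_k_on k f S"
proof (induction k arbitrary: f)
  case 0
  then show ?case
    by (auto intro!: continuous_at_imp_continuous_on differentiable_imp_continuous_within)
qed simp

lemma C_k_on_0_const: "C_k_on k (\<lambda>x. 0) S"
  by (induction k) simp_all

lemma C_k_on_add:
  assumes "open S" "C_k_on k f S" "C_k_on k g S"
  shows "C_k_on k (\<lambda>x. f x + g x) S"
  using assms(2,3)
proof (induction k arbitrary: f g)
  case 0
  then show ?case by (auto intro: continuous_on_add)
next
  case (Suc k)
  have "C_k_on k (\<lambda>x. frechet_derivative (\<lambda>x. f x + g x) (at x) v) S" for v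
  proof (rule C_k_on_cong[OF assms(1)])
    show "C_k_on k (\<lambda>x. frechet_derivative f (at x) v + frechet_derivative g (at x) v) S"
      using Suc by simp
    fix y assume "y \<in> S"
    then show "frechet_derivative f (at y) v + frechet_derivative g (at y) v =
        frechet_derivative (\<lambda>x. f x + g x) (at y) v"
      using Suc.prems
      by (subst frechet_derivative_eqI[OF has_derivative_add])
         (auto intro!: frechet_derivative_works[THEN iffD1])
  qed
  then show ?case using Suc.prems by simp
qed

lemma C_k_on_sum:
  assumes "open S" "\<And>i. i \<in> I \<Longrightarrow> C_k_on k (f i) S"
  shows "C_k_on k (\<lambda>x. \<Sum>i\<in>I. f i x) S"
  using assms(2)
  by (induction I rule: infinite_finite_induct) (auto simp: C_k_on_0_const intro: C_k_on_add[OF assms(1)])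

lemma C_k_on_scaleR:
  fixes a :: "'a::real_normed_vector \<Rightarrow> real"
  assumes "open S" "C_k_on k a S" "C_k_on k f S"
  shows "C_k_on k (\<lambda>x. a x *\<^sub>R f x) S"
  using assms(2,3)
proof (induction k arbitrary: a f)
  case 0
  then show ?case by (auto intro: continuous_on_scaleR)
next
  case (Suc k)
  have D: "((\<lambda>x. a x *\<^sub>R f x) has_derivative
      (\<lambda>v. a y *\<^sub>R frechet_derivative f (at y) v + frechet_derivative a (at y) v *\<^sub>R f y)) (at y)"
    if "y \<in> S" for y
    using Suc.prems that by (auto simp: frechet_derivative_works[symmetric] intro!: frechet_derivative_works[THEN iffD1] has_derivative_scaleR)
  have "C_k_on k (\<lambda>x. frechet_derivative (\<lambda>x. a x *\<^sub>R f x) (at x) v) S" for v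
  proof (rule C_k_on_cong[OF assms(1)])
    show "C_k_on k (\<lambda>y. a y *\<^sub>R frechet_derivative f (at y) v + frechet_derivative a (at y) v *\<^sub>R f y) S"
      using Suc.prems[THEN C_k_on_SucD] Suc.prems
      by (intro C_k_on_add[OF assms(1)] Suc.IH) simp_all
    fix y assume "y \<in> S"
    then show "a y *\<^sub>R frechet_derivative f (at y) v + frechet_derivative a (at y) v *\<^sub>R f y =
        frechet_derivative (\<lambda>x. a x *\<^sub>R f x) (at y) v"
      using frechet_derivative_eqI[OF D] by simp
  qed
  moreover have "(\<lambda>x. a x *\<^sub>R f x) differentiable (at y)" if "y \<in> S" for y
    using D[OF that] by (auto simp: differentiable_def)
  ultimately show ?case by simp
qed

lemma C_k_on_inner_const:
  fixes f :: "'a::real_normed_vector \<Rightarrow> 'b::real_inner"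
  assumes "open S" "C_k_on k f S"
  shows "C_k_on k (\<lambda>x. f x \<bullet> b) S"
  using assms(2)
proof (induction k arbitrary: f)
  case 0
  then show ?case by (auto intro: continuous_intros)
next
  case (Suc k)
  have D: "((\<lambda>x. f x \<bullet> b) has_derivative (\<lambda>v. frechet_derivative f (at y) v \<bullet> b)) (at y)"
    if "y \<in> S" for y
    using Suc.prems that by (auto simp: frechet_derivative_works[symmetric] intro!: frechet_derivative_works[THEN iffD1] has_derivative_inner_left)
  have "C_k_on k (\<lambda>x. frechet_derivative (\<lambda>x. f x \<bullet> b) (at x) v) S" for v
  proof (rule C_k_on_cong[OF assms(1)])
    show "C_k_on k (\<lambda>y. frechet_derivative f (at y) v \<bullet> b) S"
      using Suc by simp
    fix y assume "y \<in> S"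
    then show "frechet_derivative f (at y) v \<bullet> b = frechet_derivative (\<lambda>x. f x \<bullet> b) (at y) v"
      using frechet_derivative_eqI[OF D] by simp
  qed
  moreover have "(\<lambda>x. f x \<bullet> b) differentiable (at y)" if "y \<in> S" for y
    using D[OF that] by (auto simp: differentiable_def)
  ultimately show ?case by simp
qed

subsection \<open>Symmetry of second derivatives\<close>

text \<open>The second difference is the increment along \<open>u\<close> of an increment along
  \<open>v\<close>. The mean value theorem is applied along \<open>u\<close>, then to the resulting
  \<open>u\<close>-derivative along \<open>v\<close>.\<close>

lemma second_difference_mean_value:
  fixes f :: "'a::real_normed_vector \<Rightarrow> real"
  assumes S: "\<And>s t. 0 \<le> s \<Longrightarrow> s \<le> h \<Longrightarrow> 0 \<le> t \<Longrightarrow> t \<le> h \<Longrightarrow> x + s *\<^sub>R u + t *\<^sub>R v \<in> S"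
    and f: "\<And>y. y \<in> S \<Longrightarrow> f differentiable (at y)"
    and Df: "\<And>y. y \<in> S \<Longrightarrow> (\<lambda>y. frechet_derivative f (at y) u) differentiable (at y)"
    and "h > 0"
  shows "\<exists>s t. 0 \<le> s \<and> s \<le> h \<and> 0 \<le> t \<and> t \<le> h \<and>
    f (x + h *\<^sub>R u + h *\<^sub>R v) - f (x + h *\<^sub>R u) - f (x + h *\<^sub>R v) + f x =
    h * (h * frechet_derivative (\<lambda>y. frechet_derivative f (at y) u) (at (x + s *\<^sub>R u + t *\<^sub>R v)) v)"
proof -
  have line: "((\<lambda>s. g (p + s *\<^sub>R w)) has_real_derivative frechet_derivative g (at (p + r *\<^sub>R w)) w) (at r)"
    if "g differentiable (at (p + r *\<^sub>R w))" for g :: "'a \<Rightarrow> real" and p w r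
  proof -
    have "((\<lambda>s. p + s *\<^sub>R w) has_derivative (\<lambda>s. s *\<^sub>R w)) (at r)"
      by (auto intro!: derivative_eq_intros)
    moreover have g: "(g has_derivative frechet_derivative g (at (p + r *\<^sub>R w))) (at (p + r *\<^sub>R w))"
      using that frechet_derivative_works by blast
    ultimately have "(g \<circ> (\<lambda>s. p + s *\<^sub>R w) has_derivative
        frechet_derivative g (at (p + r *\<^sub>R w)) \<circ> (\<lambda>s. s *\<^sub>R w)) (at r)"
      by (rule diff_chain_at)
    moreover have "frechet_derivative g (at (p + r *\<^sub>R w)) \<circ> (\<lambda>s. s *\<^sub>R w)
        = (*) (frechet_derivative g (at (p + r *\<^sub>R w)) w)"
      using linear_scale[OF has_derivative_linear[OF g]] by (auto simp: o_def)
    ultimately show ?thesis by (simp add: has_field_derivative_def o_def)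
  qed
  define g where "g s = f ((x + h *\<^sub>R v) + s *\<^sub>R u) - f (x + s *\<^sub>R u)" for s
  define g' where "g' s = frechet_derivative f (at ((x + h *\<^sub>R v) + s *\<^sub>R u)) u
    - frechet_derivative f (at (x + s *\<^sub>R u)) u" for s
  have mem: "(x + h *\<^sub>R v) + s *\<^sub>R u \<in> S" "x + s *\<^sub>R u \<in> S" if "0 \<le> s" "s \<le> h" for s
    using S[of s h] S[of s 0] that \<open>h > 0\<close> by (simp_all add: algebra_simps)
  have "\<forall>s. 0 \<le> s \<and> s \<le> h \<longrightarrow> DERIV g s :> g' s"
    unfolding g_def g'_def using mem f by (auto intro!: DERIV_diff line)
  then obtain s where s: "0 < s" "s < h" "g h - g 0 = (h - 0) * g' s"
    using MVT2[of 0 h g g'] \<open>h > 0\<close> by blast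
  define k where "k t = frechet_derivative f (at ((x + s *\<^sub>R u) + t *\<^sub>R v)) u" for t
  define k' where "k' t =
    frechet_derivative (\<lambda>y. frechet_derivative f (at y) u) (at ((x + s *\<^sub>R u) + t *\<^sub>R v)) v" for t
  have "\<forall>t. 0 \<le> t \<and> t \<le> h \<longrightarrow> DERIV k t :> k' t"
    unfolding k_def k'_def using S s by (auto intro!: line Df)
  then obtain t where t: "0 < t" "t < h" "k h - k 0 = (h - 0) * k' t"
    using MVT2[of 0 h k k'] \<open>h > 0\<close> by blast
  have "g' s = k h - k 0" by (simp add: g'_def k_def algebra_simps)
  moreover have "g h - g 0 = f (x + h *\<^sub>R u + h *\<^sub>R v) - f (x + h *\<^sub>R u) - f (x + h *\<^sub>R v) + f x"
    by (simp add: g_def algebra_simps)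
  ultimately show ?thesis using s t by (intro exI[of _ s] exI[of _ t]) (simp add: k'_def)
qed

text \<open>The second difference is symmetric in \<open>u\<close> and \<open>v\<close>, so the two
  mixed derivatives agree at suitable points of any small parallelogram at \<open>x\<close>;
  continuity carries this to \<open>x\<close>.\<close>

lemma second_derivative_commute_real:
  fixes f :: "'a::real_normed_vector \<Rightarrow> real"
  assumes "open S" "C_k_on 2 f S" "x \<in> S"
  shows "frechet_derivative (\<lambda>y. frechet_derivative f (at y) u) (at x) v =
    frechet_derivative (\<lambda>y. frechet_derivative f (at y) v) (at x) u"
proof -
  define D where "D u v y = frechet_derivative (\<lambda>y. frechet_derivative f (at y) u) (at y) v" for u v y
  have f: "f differentiable (at y)" "(\<lambda>y. frechet_derivative f (at y) w) differentiable (at y)"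
    "continuous_on S (D w w')" if "y \<in> S" for y w w'
    using assms(2) that by (auto simp: numeral_2_eq_2 D_def[abs_def])
  have cont: "isCont (D u v) x" "isCont (D v u) x"
    using f(3)[OF assms(3)] assms(1,3) by (auto simp: continuous_on_eq_continuous_at)
  have "\<bar>D u v x - D v u x\<bar> < e" if "e > 0" for e
  proof -
    obtain d1 where d1: "d1 > 0" "\<And>y. dist y x < d1 \<Longrightarrow> \<bar>D u v y - D u v x\<bar> < e / 2"
      using cont(1) \<open>e > 0\<close> unfolding continuous_at_eps_delta dist_real_def
      by (metis half_gt_zero)
    obtain d2 where d2: "d2 > 0" "\<And>y. dist y x < d2 \<Longrightarrow> \<bar>D v u y - D v u x\<bar> < e / 2"
      using cont(2) \<open>e > 0\<close> unfolding continuous_at_eps_delta dist_real_def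
      by (metis half_gt_zero)
    obtain d3 where d3: "d3 > 0" "ball x d3 \<subseteq> S"
      using assms(1,3) open_contains_ball by blast
    define d where "d = min d1 (min d2 d3)"
    have "d > 0" using d1 d2 d3 by (simp add: d_def)
    \<comment> \<open>The summand 1 keeps \<open>a\<close> positive when both directions vanish;
      \<open>h * a = d / 2\<close> puts the parallelogram inside the ball of radius
      \<open>d\<close>.\<close>
    define a where "a = norm u + norm v + 1"
    define h where "h = d / (2 * a)"
    have h: "h > 0" "h * (norm u + norm v) < d"
    proof -
      have pos: "a > 0" by (simp add: a_def add_nonneg_pos)
      then show "h > 0" using \<open>d > 0\<close> by (simp add: h_def)
      have "h * a = d / 2" using pos by (simp add: h_def)
      then show "h * (norm u + norm v) < d"
        using \<open>h > 0\<close> \<open>d > 0\<close> by (simp add: a_def algebra_simps)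
    qed
    have near: "dist (x + s *\<^sub>R u + t *\<^sub>R v) x < d" if "0 \<le> s" "s \<le> h" "0 \<le> t" "t \<le> h" for s t
    proof -
      have "norm (s *\<^sub>R u + t *\<^sub>R v) \<le> s * norm u + t * norm v"
        using norm_triangle_ineq[of "s *\<^sub>R u" "t *\<^sub>R v"] that by simp
      also have "\<dots> \<le> h * norm u + h * norm v"
        using that by (intro add_mono mult_right_mono) auto
      finally show ?thesis using h(2) by (simp add: dist_norm algebra_simps)
    qed
    have S: "x + s *\<^sub>R u + t *\<^sub>R v \<in> S" if "0 \<le> s" "s \<le> h" "0 \<le> t" "t \<le> h" for s t
      using near[OF that] d3 by (auto simp: d_def dist_commute)
    obtain s t where st: "0 \<le> s" "s \<le> h" "0 \<le> t" "t \<le> h"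
        "f (x + h *\<^sub>R u + h *\<^sub>R v) - f (x + h *\<^sub>R u) - f (x + h *\<^sub>R v) + f x =
          h * (h * D u v (x + s *\<^sub>R u + t *\<^sub>R v))"
      using second_difference_mean_value[of h x u v S f] S f h(1) unfolding D_def by blast
    have S': "x + t *\<^sub>R v + s *\<^sub>R u \<in> S" if "0 \<le> t" "t \<le> h" "0 \<le> s" "s \<le> h" for s t
      using S[OF that(3,4,1,2)] by (simp add: algebra_simps)
    obtain t' s' where st': "0 \<le> t'" "t' \<le> h" "0 \<le> s'" "s' \<le> h"
        "f (x + h *\<^sub>R v + h *\<^sub>R u) - f (x + h *\<^sub>R v) - f (x + h *\<^sub>R u) + f x =
          h * (h * D v u (x + t' *\<^sub>R v + s' *\<^sub>R u))"
      using second_difference_mean_value[of h x v u S f] S' f h(1) unfolding D_def by blast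
    have swap: "x + h *\<^sub>R v + h *\<^sub>R u = x + h *\<^sub>R u + h *\<^sub>R v"
        "x + t' *\<^sub>R v + s' *\<^sub>R u = x + s' *\<^sub>R u + t' *\<^sub>R v"
      by simp_all
    have "h * (h * D u v (x + s *\<^sub>R u + t *\<^sub>R v)) = h * (h * D v u (x + s' *\<^sub>R u + t' *\<^sub>R v))"
      using st(5) st'(5)[unfolded swap] by linarith
    then have "D u v (x + s *\<^sub>R u + t *\<^sub>R v) = D v u (x + s' *\<^sub>R u + t' *\<^sub>R v)"
      using h(1) by simp
    moreover have "\<bar>D u v (x + s *\<^sub>R u + t *\<^sub>R v) - D u v x\<bar> < e / 2"
      using near[OF st(1-4)] by (intro d1(2)) (simp add: d_def)
    moreover have "\<bar>D v u (x + s' *\<^sub>R u + t' *\<^sub>R v) - D v u x\<bar> < e / 2"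
      using near[OF st'(3,4,1,2)] by (intro d2(2)) (simp add: d_def)
    ultimately show ?thesis by linarith
  qed
  from this[of "\<bar>D u v x - D v u x\<bar>"] have "D u v x = D v u x" by auto
  then show ?thesis by (simp add: D_def)
qed

lemma second_derivative_commute:
  fixes f :: "'a::real_normed_vector \<Rightarrow> 'b::euclidean_space"
  assumes "open S" "C_k_on 2 f S" "x \<in> S"
  shows "frechet_derivative (\<lambda>y. frechet_derivative f (at y) u) (at x) v =
    frechet_derivative (\<lambda>y. frechet_derivative f (at y) v) (at x) u"
proof (rule euclidean_eqI)
  fix b :: 'b assume "b \<in> Basis"
  have D: "frechet_derivative (\<lambda>x. g x \<bullet> b) (at y) w = frechet_derivative g (at y) w \<bullet> b"
    if "g differentiable (at y)" for g :: "'a \<Rightarrow> 'b" and y w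
    by (rule fun_cong[OF frechet_derivative_eqI])
       (intro has_derivative_inner_left that[unfolded frechet_derivative_works])
  have f: "f differentiable (at y)" "(\<lambda>y. frechet_derivative f (at y) w) differentiable (at y)"
    if "y \<in> S" for y w
    using assms(2) that by (auto simp: numeral_2_eq_2)
  have "frechet_derivative (\<lambda>y. frechet_derivative (\<lambda>x. f x \<bullet> b) (at y) w) (at x) w'
      = frechet_derivative (\<lambda>y. frechet_derivative f (at y) w) (at x) w' \<bullet> b" for w w'
    using frechet_derivative_cong_open[OF assms(1,3), of
        "\<lambda>y. frechet_derivative (\<lambda>x. f x \<bullet> b) (at y) w" "\<lambda>y. frechet_derivative f (at y) w \<bullet> b"]
      D[OF f(1)] D[OF f(2)[OF assms(3)]] by auto
  then show "frechet_derivative (\<lambda>y. frechet_derivative f (at y) u) (at x) v \<bullet> b =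
      frechet_derivative (\<lambda>y. frechet_derivative f (at y) v) (at x) u \<bullet> b"
    using second_derivative_commute_real[OF assms(1) C_k_on_inner_const[OF assms(1,2)] assms(3), of b u v]
    by simp
qed

text \<open>In the product rule the mixed second derivatives of \<Phi> cancel. With push-forwards of
  coordinate fields for \<Phi> and \<Psi>, this carries the information of the Gauss
  equation.\<close>

lemma second_derivative_pairing:
  fixes \<Phi> \<Psi> :: "'a::real_normed_vector \<Rightarrow> 'b::euclidean_space"
  assumes "open S" "C_k_on 2 \<Phi> S" "C_k_on 2 \<Psi> S" "x \<in> S"
  shows "frechet_derivative (\<lambda>y. frechet_derivative \<Phi> (at y) u \<bullet> \<Psi> y) (at x) v -
      frechet_derivative (\<lambda>y. frechet_derivative \<Phi> (at y) v \<bullet> \<Psi> y) (at x) u =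
      frechet_derivative \<Phi> (at x) u \<bullet> frechet_derivative \<Psi> (at x) v -
      frechet_derivative \<Phi> (at x) v \<bullet> frechet_derivative \<Psi> (at x) u"
proof -
  have "frechet_derivative (\<lambda>y. frechet_derivative \<Phi> (at y) w \<bullet> \<Psi> y) (at x) w' =
      frechet_derivative \<Phi> (at x) w \<bullet> frechet_derivative \<Psi> (at x) w' +
      frechet_derivative (\<lambda>y. frechet_derivative \<Phi> (at y) w) (at x) w' \<bullet> \<Psi> x" for w w'
  proof -
    have "(\<lambda>y. frechet_derivative \<Phi> (at y) w) differentiable (at x)" "\<Psi> differentiable (at x)"
      using assms by (auto simp: numeral_2_eq_2)
    then have "((\<lambda>y. frechet_derivative \<Phi> (at y) w \<bullet> \<Psi> y) has_derivative
        (\<lambda>w'. frechet_derivative \<Phi> (at x) w \<bullet> frechet_derivative \<Psi> (at x) w' +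
          frechet_derivative (\<lambda>y. frechet_derivative \<Phi> (at y) w) (at x) w' \<bullet> \<Psi> x)) (at x)"
      unfolding frechet_derivative_works by (rule has_derivative_inner)
    then show ?thesis by (simp add: frechet_derivative_eqI)
  qed
  then show ?thesis
    using second_derivative_commute[OF assms(1,2,4), of u v] by simp
qed

text \<open>A product rule when \<open>L\<close> is differentiable only on each fixed vector:
  expanding \<psi> in the basis leaves a finite sum of products.\<close>

lemma has_derivative_apply_linear:
  fixes L :: "'a::real_normed_vector \<Rightarrow> 'b::euclidean_space \<Rightarrow> 'c::real_normed_vector"
  assumes "open S" "x \<in> S" "\<And>y. y \<in> S \<Longrightarrow> linear (L y)"
    and L: "\<And>v. ((\<lambda>y. L y v) has_derivative L' v) (at x)"
    and \<psi>: "(\<psi> has_derivative \<psi>') (at x)"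
  shows "((\<lambda>y. L y (\<psi> y)) has_derivative (\<lambda>u. L' (\<psi> x) u + L x (\<psi>' u))) (at x)"
proof -
  have expand: "L y w = (\<Sum>b\<in>Basis. (w \<bullet> b) *\<^sub>R L y b)" if "y \<in> S" for y w
    using linear_sum[OF assms(3)[OF that], of "\<lambda>b. (w \<bullet> b) *\<^sub>R b" Basis] linear_scale[OF assms(3)[OF that]]
    by (simp add: euclidean_representation)
  \<comment> \<open>Linearity of \<open>L'\<close> in \<open>w\<close> is inherited from
    \<open>L\<close> by uniqueness of derivatives.\<close>
  have expand': "L' w u = (\<Sum>b\<in>Basis. (w \<bullet> b) *\<^sub>R L' b u)" for w u
  proof -
    have "((\<lambda>y. \<Sum>b\<in>Basis. (w \<bullet> b) *\<^sub>R L y b) has_derivative (\<lambda>u. \<Sum>b\<in>Basis. (w \<bullet> b) *\<^sub>R L' b u)) (at x)"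
      by (intro has_derivative_sum has_derivative_scaleR_right L)
    then have "((\<lambda>y. L y w) has_derivative (\<lambda>u. \<Sum>b\<in>Basis. (w \<bullet> b) *\<^sub>R L' b u)) (at x)"
      by (rule has_derivative_transform_within_open[OF _ assms(1,2)]) (simp add: expand[symmetric])
    then have "L' w = (\<lambda>u. \<Sum>b\<in>Basis. (w \<bullet> b) *\<^sub>R L' b u)"
      by (rule has_derivative_unique[OF L])
    then show ?thesis by simp
  qed
  have "((\<lambda>y. \<Sum>b\<in>Basis. (\<psi> y \<bullet> b) *\<^sub>R L y b) has_derivative
      (\<lambda>u. \<Sum>b\<in>Basis. (\<psi> x \<bullet> b) *\<^sub>R L' b u + (\<psi>' u \<bullet> b) *\<^sub>R L x b)) (at x)"
    by (intro has_derivative_sum has_derivative_scaleR L has_derivative_inner_left \<psi>)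
  moreover have "(\<Sum>b\<in>Basis. (\<psi> x \<bullet> b) *\<^sub>R L' b u + (\<psi>' u \<bullet> b) *\<^sub>R L x b) =
      L' (\<psi> x) u + L x (\<psi>' u)" for u
    unfolding sum.distrib
    by (subst expand'[of "\<psi> x" u], subst expand[OF assms(2), of "\<psi>' u"]) (rule refl)
  ultimately have "((\<lambda>y. \<Sum>b\<in>Basis. (\<psi> y \<bullet> b) *\<^sub>R L y b) has_derivative
      (\<lambda>u. L' (\<psi> x) u + L x (\<psi>' u))) (at x)"
    by simp
  then show ?thesis
    by (rule has_derivative_transform_within_open[OF _ assms(1,2)]) (rule expand[symmetric])
qed

text \<open>\<open>L0\<close> together with \<open>w0\<close> forms an injective linear map
  \<open>M\<close>, which is bounded below, and this survives small perturbations. It serves in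
  place of continuity of the projection to a moving normal space.\<close>

lemma eventually_not_in_range:
  fixes L :: "'a \<Rightarrow> 'e::euclidean_space \<Rightarrow> 'k::euclidean_space"
  assumes lin: "\<forall>\<^sub>F y in F. linear (L y)" and lin0: "linear L0" "inj L0"
    and L: "\<And>v. ((\<lambda>y. L y v) \<longlongrightarrow> L0 v) F"
    and w: "(w \<longlongrightarrow> w0) F" and w0: "w0 \<notin> range L0"
  shows "\<forall>\<^sub>F y in F. w y \<notin> range (L y)"
proof -
  define M where "M p = L0 (fst p) + snd p *\<^sub>R w0" for p :: "'e \<times> real"
  have "linear M"
    by (rule linearI)
       (simp_all add: M_def linear_add[OF lin0(1)] linear_scale[OF lin0(1)] algebra_simps)
  have "p = 0" if "M p = 0" for p
  proof -
    have "snd p = 0"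
    proof (rule ccontr)
      assume "snd p \<noteq> 0"
      then have "w0 = (1 / snd p) *\<^sub>R (snd p *\<^sub>R w0)" by simp
      also have "snd p *\<^sub>R w0 = L0 (- fst p)"
        using that by (simp add: M_def linear_neg[OF lin0(1)] add_eq_0_iff)
      also have "(1 / snd p) *\<^sub>R L0 (- fst p) = L0 ((1 / snd p) *\<^sub>R (- fst p))"
        using linear_scale[OF lin0(1)] by metis
      finally show False using w0 by blast
    qed
    moreover from this have "fst p = 0"
      using that linear_injective_0[OF lin0(1)] lin0(2) by (simp add: M_def)
    ultimately show ?thesis by (simp add: prod_eq_iff)
  qed
  then obtain e where e: "e > 0" "\<And>p. norm (M p) \<ge> e * norm p"
    using injective_imp_isometric[of UNIV M] \<open>linear M\<close>
    by (auto simp: linear_conv_bounded_linear)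
  \<comment> \<open>Bounds the deviation of the perturbed map at \<open>y\<close> from
    \<open>M\<close>, relative to \<open>norm p\<close>.\<close>
  define s where "s y = (\<Sum>b\<in>Basis. norm (L y b - L0 b)) + norm (w y - w0)" for y
  have "(s \<longlongrightarrow> (\<Sum>b\<in>(Basis::'e set). norm (L0 b - L0 b)) + norm (w0 - w0)) F"
    unfolding s_def by (intro tendsto_intros L w)
  then have "\<forall>\<^sub>F y in F. s y < e"
    using e(1) by (intro order_tendstoD(2)) auto
  with lin show ?thesis
  proof eventually_elim
    case (elim y)
    show "w y \<notin> range (L y)"
    proof
      assume "w y \<in> range (L y)"
      then obtain z where z: "w y = L y z" by auto
      \<comment> \<open>A nonzero vector killed by the perturbed map, although \<open>M\<close>
        stretches it by at least \<open>e\<close>.\<close>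
      define p where "p = (- z, 1::real)"
      have "linear (\<lambda>v. L y v - L0 v)"
        using elim(1) lin0(1) by (intro linear_compose_sub)
      then have "L y z - L0 z = (\<Sum>b\<in>Basis. (z \<bullet> b) *\<^sub>R (L y b - L0 b))"
        using linear_sum[of "\<lambda>v. L y v - L0 v" "\<lambda>b. (z \<bullet> b) *\<^sub>R b" Basis]
          linear_scale[of "\<lambda>v. L y v - L0 v"]
        by (simp add: euclidean_representation)
      then have "norm (L y z - L0 z) \<le> (\<Sum>b\<in>Basis. norm ((z \<bullet> b) *\<^sub>R (L y b - L0 b)))"
        by (simp only: norm_sum)
      also have "\<dots> \<le> (\<Sum>b\<in>Basis. norm p * norm (L y b - L0 b))"
      proof (rule sum_mono)
        fix b :: 'e assume "b \<in> Basis"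
        then have "\<bar>z \<bullet> b\<bar> \<le> norm z" by (rule Basis_le_norm)
        also have "norm z \<le> norm p" using norm_fst_le[of "- z" "1::real"] by (simp add: p_def)
        finally show "norm ((z \<bullet> b) *\<^sub>R (L y b - L0 b)) \<le> norm p * norm (L y b - L0 b)"
          by (simp add: mult_right_mono)
      qed
      finally have 1: "norm (L y z - L0 z) \<le> norm p * (\<Sum>b\<in>Basis. norm (L y b - L0 b))"
        by (simp add: sum_distrib_left)
      have "1 \<le> norm p" using norm_snd_le[of "1::real" "- z"] by (simp add: p_def)
      then have 2: "norm (w y - w0) \<le> norm p * norm (w y - w0)"
        using mult_right_mono[of 1 "norm p" "norm (w y - w0)"] by simp
      have "M p = (L y z - L0 z) - (w y - w0)"
        by (simp add: M_def p_def z linear_neg[OF lin0(1)])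
      then have "norm (M p) \<le> norm (L y z - L0 z) + norm (w y - w0)"
        by (simp add: norm_triangle_ineq4)
      also have "\<dots> \<le> norm p * s y" using 1 2 by (simp add: s_def algebra_simps)
      finally have "e * norm p \<le> norm p * s y" using e(2)[of p] by simp
      then have "norm p * (e - s y) \<le> 0" by (simp add: algebra_simps)
      moreover have "norm p * (e - s y) > 0"
        using elim(2) \<open>1 \<le> norm p\<close> by (intro mult_pos_pos) auto
      ultimately show False by simp
    qed
  qed
qed

section \<open>Orthogonal projections\<close>

lemma orth_proj_eqI:
  assumes "subspace S" "w \<in> S" "v - w \<in> S\<^sup>\<bottom>"
  shows "orth_proj S v = w"
  unfolding orth_proj_def
proof (rule the_equality)
  fix w' assume "w' \<in> S \<and> v - w' \<in> S\<^sup>\<bottom>"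
  then have "w' - w \<in> S" "(v - w) - (v - w') \<in> S\<^sup>\<bottom>"
    using assms subspace_diff subspace_orthogonal_comp by blast+
  then have "w' - w \<in> S \<inter> S\<^sup>\<bottom>" by simp
  then show "w' = w"
    using assms(1) by (simp add: orthogonal_Int_0)
qed (use assms in auto)

lemma orth_proj:
  assumes "subspace S"
  shows "orth_proj S v \<in> S" "v - orth_proj S v \<in> S\<^sup>\<bottom>"
proof -
  obtain a b where ab: "v = a + b" "a \<in> S" "b \<in> S\<^sup>\<bottom>"
    using subspace_sum_orthogonal_comp[OF assms] set_plus_elim[of v S "S\<^sup>\<bottom>"] by auto
  then have "orth_proj S v = a" using assms by (intro orth_proj_eqI) auto
  then show "orth_proj S v \<in> S" "v - orth_proj S v \<in> S\<^sup>\<bottom>" using ab by auto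
qed

lemma linear_orth_proj:
  assumes "subspace S"
  shows "linear (orth_proj S)"
proof (rule linearI)
  show "orth_proj S (x + y) = orth_proj S x + orth_proj S y" for x y
  proof (rule orth_proj_eqI[OF assms])
    have "(x - orth_proj S x) + (y - orth_proj S y) \<in> S\<^sup>\<bottom>"
      by (intro subspace_add[OF subspace_orthogonal_comp] orth_proj assms)
    then show "x + y - (orth_proj S x + orth_proj S y) \<in> S\<^sup>\<bottom>" by (simp add: algebra_simps)
  qed (intro subspace_add assms orth_proj)
  show "orth_proj S (r *\<^sub>R x) = r *\<^sub>R orth_proj S x" for r x
  proof (rule orth_proj_eqI[OF assms])
    have "r *\<^sub>R (x - orth_proj S x) \<in> S\<^sup>\<bottom>"
      by (intro subspace_scale[OF subspace_orthogonal_comp] orth_proj assms)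
    then show "r *\<^sub>R x - r *\<^sub>R orth_proj S x \<in> S\<^sup>\<bottom>" by (simp add: algebra_simps)
  qed (intro subspace_scale assms orth_proj)
qed

lemma orth_proj_eq_0_iff:
  assumes "subspace S"
  shows "orth_proj S v = 0 \<longleftrightarrow> v \<in> S\<^sup>\<bottom>"
proof
  show "v \<in> S\<^sup>\<bottom>" if "orth_proj S v = 0" using orth_proj(2)[OF assms, of v] that by simp
  show "orth_proj S v = 0" if "v \<in> S\<^sup>\<bottom>"
    using assms that by (intro orth_proj_eqI) (auto simp: subspace_0)
qed

section \<open>Kaehler submanifolds in a chart\<close>

text \<open>The submanifold read in one chart: \<open>F\<close> is the immersion, \<open>K\<close>
  and \<open>G\<close> are the components of the complex structure and the metric. Identities hold
  on all of the open set \<open>S\<close> and can therefore be differentiated.\<close>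

locale kaehler_chart =
  fixes S :: "'e::euclidean_space set" and F :: "'e \<Rightarrow> real^'n"
    and K :: "'e \<Rightarrow> 'e \<Rightarrow> 'e" and G :: "'e \<Rightarrow> 'e \<Rightarrow> 'e \<Rightarrow> real"
  assumes S: "open S" and F: "smooth_on F S"
    and inj: "y \<in> S \<Longrightarrow> inj (frechet_derivative F (at y))"
    and K_linear: "y \<in> S \<Longrightarrow> linear (K y)" and KK: "y \<in> S \<Longrightarrow> K y (K y v) = - v"
    and K_smooth: "smooth_on (\<lambda>y. K y v) S"
    and G: "y \<in> S \<Longrightarrow> G y u v = frechet_derivative F (at y) u \<bullet> frechet_derivative F (at y) v"
    and GK: "y \<in> S \<Longrightarrow> G y (K y u) (K y v) = G y u v"
    and parallel: "y \<in> S \<Longrightarrow>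
      frechet_derivative (\<lambda>y'. K y' v) (at y) u + levi_civita G y u (K y v)
        = K y (levi_civita G y u v)"
begin

definition D1 :: "'e \<Rightarrow> 'e \<Rightarrow> real^'n" where
  "D1 y v = frechet_derivative F (at y) v"

definition D2 :: "'e \<Rightarrow> 'e \<Rightarrow> 'e \<Rightarrow> real^'n" where
  "D2 y u v = frechet_derivative (\<lambda>y. D1 y v) (at y) u"

definition sff :: "'e \<Rightarrow> 'e \<Rightarrow> 'e \<Rightarrow> real^'n" where
  "sff y u v = orth_proj ((range (D1 y))\<^sup>\<bottom>) (D2 y u v)"

lemma C_k: "C_k_on k F S" "C_k_on k (\<lambda>y. D1 y v) S" "C_k_on k (\<lambda>y. D2 y u v) S"
  "C_k_on k (\<lambda>y. K y v) S"
proof -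
  have k: "C_k_on k F S" for k using F by (simp add: smooth_on_def)
  then show "C_k_on k F S" .
  show "C_k_on k (\<lambda>y. D1 y v) S" using k[of "Suc k"] by (simp add: D1_def)
  show "C_k_on k (\<lambda>y. D2 y u v) S" using k[of "Suc (Suc k)"] by (simp add: D1_def D2_def)
  show "C_k_on k (\<lambda>y. K y v) S" using K_smooth by (simp add: smooth_on_def)
qed

lemma differentiable_at:
  assumes "y \<in> S"
  shows "F differentiable (at y)" "(\<lambda>y. D1 y v) differentiable (at y)"
    "(\<lambda>y. K y v) differentiable (at y)"
  using C_k(1)[of 1] C_k(2)[of 1] C_k(4)[of 1] assms by auto

lemma D1_linear: "y \<in> S \<Longrightarrow> linear (D1 y)"
  using differentiable_at(1) linear_frechet_derivative by (auto simp: D1_def[abs_def])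

lemma D1_inj: "y \<in> S \<Longrightarrow> inj (D1 y)"
  using inj by (simp add: D1_def[abs_def])

lemma D1_has_derivative: "y \<in> S \<Longrightarrow> ((\<lambda>y. D1 y v) has_derivative (\<lambda>u. D2 y u v)) (at y)"
  using differentiable_at(2) by (simp add: D2_def frechet_derivative_works)

lemma D2_commute: "y \<in> S \<Longrightarrow> D2 y u v = D2 y v u"
  unfolding D2_def D1_def by (rule second_derivative_commute[OF S C_k(1)])

lemma D2_bilinear:
  assumes "y \<in> S"
  shows "bilinear (D2 y)"
proof -
  have "linear (\<lambda>u. D2 y u v)" for v
    by (rule has_derivative_linear[OF D1_has_derivative[OF assms]])
  then show ?thesis by (simp add: bilinear_def D2_commute[OF assms])
qed

lemma sff_bilinear:
  assumes "y \<in> S"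
  shows "bilinear (sff y)"
  using D2_bilinear[OF assms]
  by (auto simp: bilinear_def sff_def[abs_def]
      intro!: linear_compose[OF _ linear_orth_proj[OF subspace_orthogonal_comp], unfolded o_def])

lemma sff_commute: "y \<in> S \<Longrightarrow> sff y u v = sff y v u"
  by (simp add: sff_def D2_commute)

lemma sff_normal: "sff y u v \<bullet> D1 y w = 0" "D1 y w \<bullet> sff y u v = 0"
  using orth_proj(1)[OF subspace_orthogonal_comp, of "range (D1 y)" "D2 y u v"]
  by (auto simp: sff_def orthogonal_comp_def orthogonal_def inner_commute)

lemma orth_proj_D1:
  assumes "y \<in> S"
  shows "orth_proj ((range (D1 y))\<^sup>\<bottom>) w = 0 \<longleftrightarrow> w \<in> range (D1 y)"
  using linear_subspace_image[OF D1_linear[OF assms] subspace_UNIV]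
  by (simp add: orth_proj_eq_0_iff subspace_orthogonal_comp orthogonal_comp_self)

text \<open>The Gauss formula. The product rule for \<open>G\<close> and the symmetry of
  \<open>D2\<close> turn the Koszul expression into twice \<open>D2 y u v\<close> paired with
  \<open>D1 y w\<close>, which determines the tangential part.\<close>

lemma D1_levi_civita:
  assumes y: "y \<in> S"
  shows "D2 y u v = sff y u v + D1 y (levi_civita G y u v)"
proof -
  have lin: "linear (D1 y)" by (rule D1_linear[OF y])
  have "D2 y u v - sff y u v \<in> range (D1 y)"
    using orth_proj(2)[OF subspace_orthogonal_comp, of "D2 y u v" "range (D1 y)"]
      orthogonal_comp_self[OF linear_subspace_image[OF lin subspace_UNIV]]
    by (simp add: sff_def)
  then obtain z where z: "D2 y u v - sff y u v = D1 y z" by auto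
  have dG: "frechet_derivative (\<lambda>y'. G y' a b) (at y) c = D1 y a \<bullet> D2 y c b + D2 y c a \<bullet> D1 y b"
    for a b c
  proof -
    have "((\<lambda>y. D1 y a \<bullet> D1 y b) has_derivative (\<lambda>c. D1 y a \<bullet> D2 y c b + D2 y c a \<bullet> D1 y b)) (at y)"
      by (intro has_derivative_inner D1_has_derivative y)
    then have "((\<lambda>y. G y a b) has_derivative (\<lambda>c. D1 y a \<bullet> D2 y c b + D2 y c a \<bullet> D1 y b)) (at y)"
      by (rule has_derivative_transform_within_open[OF _ S y]) (simp add: G D1_def)
    then show ?thesis by (simp add: frechet_derivative_eqI)
  qed
  have "levi_civita G y u v = z"
    unfolding levi_civita_def
  proof (rule the_equality)
    have "D1 y z \<bullet> D1 y w = D2 y u v \<bullet> D1 y w" for w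
      by (simp add: z[symmetric] inner_diff_left sff_normal)
    then have D: "2 * (D1 y z \<bullet> D1 y w) = D1 y v \<bullet> D2 y u w + D2 y u v \<bullet> D1 y w
       + (D1 y u \<bullet> D2 y v w + D2 y v u \<bullet> D1 y w) - (D1 y u \<bullet> D2 y w v + D2 y w u \<bullet> D1 y v)" for w
      using D2_commute[OF y] by (simp add: inner_commute)
    then show "\<forall>w. 2 * G y z w =
         frechet_derivative (\<lambda>y'. G y' v w) (at y) u
       + frechet_derivative (\<lambda>y'. G y' u w) (at y) v
       - frechet_derivative (\<lambda>y'. G y' u v) (at y) w"
      unfolding dG by (simp add: G y D1_def[symmetric])
    fix z' assume "\<forall>w. 2 * G y z' w =
         frechet_derivative (\<lambda>y'. G y' v w) (at y) u
       + frechet_derivative (\<lambda>y'. G y' u w) (at y) v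
       - frechet_derivative (\<lambda>y'. G y' u v) (at y) w"
    then have "2 * (D1 y z' \<bullet> D1 y w) = 2 * (D1 y z \<bullet> D1 y w)" for w
      unfolding dG D by (simp add: G y D1_def[symmetric])
    then have "(D1 y z' - D1 y z) \<bullet> (D1 y z' - D1 y z) = 0"
      by (simp add: inner_diff_left inner_diff_right)
    then show "z' = z" using D1_inj[OF y] by (simp add: inj_eq)
  qed
  then show ?thesis using z by (simp add: algebra_simps)
qed

text \<open>That \<open>K\<close> is parallel makes the tangential part of the derivative of \<open>F\<^sub>* K v\<close> equal to \<open>K\<close>
  applied to that of \<open>F\<^sub>* v\<close>. Hence both fields have the same connection coefficients, and the
  symmetry of second derivatives applied to both yields the same curvature.\<close>

lemma D1_K_has_derivative:
  assumes y: "y \<in> S"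
  shows "((\<lambda>y. D1 y (K y v)) has_derivative
    (\<lambda>u. sff y u (K y v) + D1 y (K y (levi_civita G y u v)))) (at y)"
proof -
  have "((\<lambda>y. K y v) has_derivative (\<lambda>u. frechet_derivative (\<lambda>y. K y v) (at y) u)) (at y)"
    using differentiable_at(3)[OF y] by (simp add: frechet_derivative_works)
  then have "((\<lambda>y. D1 y (K y v)) has_derivative
      (\<lambda>u. D2 y u (K y v) + D1 y (frechet_derivative (\<lambda>y. K y v) (at y) u))) (at y)"
    using has_derivative_apply_linear[OF S y, of D1 "\<lambda>v u. D2 y u v"] D1_linear
      D1_has_derivative[OF y] by blast
  moreover have "D2 y u (K y v) + D1 y (frechet_derivative (\<lambda>y. K y v) (at y) u) =
      sff y u (K y v) + D1 y (K y (levi_civita G y u v))" for u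
    by (simp add: D1_levi_civita[OF y] parallel[OF y, of v u, symmetric]
        linear_add[OF D1_linear[OF y]])
  ultimately show ?thesis by simp
qed

lemma C_k_D1_K: "C_k_on k (\<lambda>y. D1 y (K y v)) S"
proof (rule C_k_on_cong[OF S])
  show "C_k_on k (\<lambda>y. \<Sum>b\<in>Basis. (K y v \<bullet> b) *\<^sub>R D1 y b) S"
    by (intro C_k_on_sum C_k_on_scaleR C_k_on_inner_const C_k S)
  fix y assume "y \<in> S"
  then show "(\<Sum>b\<in>Basis. (K y v \<bullet> b) *\<^sub>R D1 y b) = D1 y (K y v)"
    using linear_sum[OF D1_linear, of y "\<lambda>b. (K y v \<bullet> b) *\<^sub>R b" Basis] linear_scale[OF D1_linear]
    by (simp add: euclidean_representation)
qed

lemma sff_curvature: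
  assumes y: "y \<in> S"
  shows "sff y X W \<bullet> sff y Y Z - sff y X Z \<bullet> sff y Y W =
    sff y X (K y W) \<bullet> sff y Y (K y Z) - sff y X (K y Z) \<bullet> sff y Y (K y W)"
proof -
  let ?\<Gamma> = "levi_civita G"
  have dX: "frechet_derivative (\<lambda>y. D1 y Z) (at y) Y = sff y Y Z + D1 y (?\<Gamma> y Y Z)"
    if "y \<in> S" for y Y Z
    using D1_levi_civita[OF that] by (simp add: D2_def)
  have dP: "frechet_derivative (\<lambda>y. D1 y (K y Z)) (at y) Y
      = sff y Y (K y Z) + D1 y (K y (?\<Gamma> y Y Z))" if "y \<in> S" for y Y Z
    using frechet_derivative_eqI[OF D1_K_has_derivative[OF that]] by simp
  have metric: "D1 y (K y a) \<bullet> D1 y (K y b) = D1 y a \<bullet> D1 y b" if "y \<in> S" for y a b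
    using GK[OF that, of a b] by (simp add: G[OF that] D1_def)
  \<comment> \<open>The normal parts drop out against tangent vectors, and \<open>K\<close> is
    isometric on the tangential ones.\<close>
  have "frechet_derivative (\<lambda>y. D1 y (K y Z)) (at y) Y \<bullet> D1 y (K y W) =
      frechet_derivative (\<lambda>y. D1 y Z) (at y) Y \<bullet> D1 y W" if "y \<in> S" for y Y Z W
    by (simp add: dX[OF that] dP[OF that] inner_add_left sff_normal metric[OF that])
  note pairing_eq = this
  have same: "frechet_derivative
      (\<lambda>y. frechet_derivative (\<lambda>y. D1 y (K y Z)) (at y) Y \<bullet> D1 y (K y W)) (at y) X =
    frechet_derivative (\<lambda>y. frechet_derivative (\<lambda>y. D1 y Z) (at y) Y \<bullet> D1 y W) (at y) X" for X Y Z W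
    by (rule fun_cong[OF frechet_derivative_cong_open[OF S y]]) (rule pairing_eq)
  show ?thesis
    \<comment> \<open>The left-hand sides coincide by \<open>same\<close>. On the right the
      tangential contributions coincide by \<open>metric\<close>, which leaves the terms in
      \<open>sff\<close>.\<close>
    using second_derivative_pairing[OF S C_k(2) C_k(2) y, of Z Y W X]
      second_derivative_pairing[OF S C_k_D1_K C_k_D1_K y, of Z Y W X]
    unfolding same
    by (simp add: dX[OF y] dP[OF y] inner_add_left inner_add_right sff_normal metric[OF y])
       (simp add: inner_commute)
qed

lemma kaehler_form_sff: "y \<in> S \<Longrightarrow> kaehler_form (sff y) (K y)"
  by (rule kaehler_form.intro)
     (blast intro: sff_bilinear sff_commute K_linear KK sff_curvature)+

text \<open>Trades the projection for membership in the range of \<open>D1 y\<close>, the form that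
  \<open>eventually_not_in_range\<close> handles.\<close>

lemma pluriharmonic_iff:
  assumes "y \<in> S"
  shows "sff y u v + sff y (K y u) (K y v) = 0 \<longleftrightarrow>
    D2 y u v + D2 y (K y u) (K y v) \<in> range (D1 y)"
  by (simp add: sff_def orth_proj_D1[OF assms, symmetric]
      linear_add[OF linear_orth_proj[OF subspace_orthogonal_comp]])

lemma eventually_not_pluriharmonic:
  assumes y: "y \<in> S" and "sff y u v + sff y (K y u) (K y v) \<noteq> 0"
  shows "\<forall>\<^sub>F y' in nhds y. sff y' u v + sff y' (K y' u) (K y' v) \<noteq> 0"
proof -
  have inS: "\<forall>\<^sub>F y' in nhds y. y' \<in> S" using S y eventually_nhds by blast
  have lim: "(f \<longlongrightarrow> f y) (nhds y)" if "C_k_on 0 f S" for f :: "'e \<Rightarrow> 'b::real_normed_vector"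
    using that S y by (simp add: continuous_on_eq_continuous_at isCont_def tendsto_nhds_iff)
  \<comment> \<open>The arguments \<open>K y u\<close>, \<open>K y v\<close> move with
    \<open>y\<close>; in basis coordinates every factor is visibly continuous.\<close>
  let ?w = "\<lambda>y. D2 y u v + (\<Sum>a\<in>Basis. \<Sum>b\<in>Basis. ((K y u \<bullet> a) * (K y v \<bullet> b)) *\<^sub>R D2 y a b)"
  have w: "D2 y u v + D2 y (K y u) (K y v) = ?w y" if "y \<in> S" for y
    using bilinear_sum[OF D2_bilinear[OF that], of "\<lambda>a. (K y u \<bullet> a) *\<^sub>R a" Basis "\<lambda>b. (K y v \<bullet> b) *\<^sub>R b" Basis]
    by (simp add: euclidean_representation bilinear_lmul[OF D2_bilinear[OF that]]
       bilinear_rmul[OF D2_bilinear[OF that]] sum.cartesian_product mult.commute)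
  have "\<forall>\<^sub>F y' in nhds y. ?w y' \<notin> range (D1 y')"
  proof (rule eventually_not_in_range)
    show "\<forall>\<^sub>F y' in nhds y. linear (D1 y')"
      using inS by eventually_elim (rule D1_linear)
    show "((\<lambda>y. D1 y v) \<longlongrightarrow> D1 y v) (nhds y)" for v by (rule lim[OF C_k(2)])
    show "(?w \<longlongrightarrow> ?w y) (nhds y)"
      by (intro tendsto_intros lim C_k)
    show "?w y \<notin> range (D1 y)"
      using assms(2) pluriharmonic_iff[OF y] w[OF y] by metis
  qed (use D1_linear D1_inj y in auto)
  with inS show ?thesis
    by eventually_elim (simp add: pluriharmonic_iff w)
qed

end

section \<open>Traces with respect to orthonormal frames\<close>

text \<open>Pairing with a frame vector reads off its coefficient, so the frame is independent, and
  by its cardinality it spans.\<close>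

lemma orthonormal_frame_expansion:
  fixes b :: "'e::euclidean_space \<Rightarrow> 'e \<Rightarrow> real"
  assumes b: "bilinear b" and B: "orthonormal_frame b B"
  shows "u = (\<Sum>w\<in>B. b u w *\<^sub>R w)"
proof -
  have fin: "finite B" and card: "card B = DIM('e)"
    and on: "\<And>u v. u \<in> B \<Longrightarrow> v \<in> B \<Longrightarrow> b u v = (if u = v then 1 else 0)"
    using B by (auto simp: orthonormal_frame_def)
  have coeff: "b (\<Sum>v\<in>B. c v *\<^sub>R v) w = c w" if "w \<in> B" for c w
  proof -
    have "b (\<Sum>v\<in>B. c v *\<^sub>R v) w = (\<Sum>v\<in>B. c v * b v w)"
      using linear_sum[of "\<lambda>u. b u w" "\<lambda>v. c v *\<^sub>R v" B] b
      by (simp add: bilinear_lmul[OF b]) (simp add: bilinear_def)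
    also have "\<dots> = (\<Sum>v\<in>B. if v = w then c v else 0)"
      using on that by (intro sum.cong) auto
    also have "\<dots> = c w" using fin that by simp
    finally show ?thesis .
  qed
  have "independent B"
  proof (rule independent_if_scalars_zero[OF fin])
    fix c w assume "(\<Sum>v\<in>B. c v *\<^sub>R v) = 0" "w \<in> B"
    then show "c w = 0" using coeff[of w c] bilinear_lzero[OF b] by simp
  qed
  then have "UNIV \<subseteq> span B"
    using card by (intro card_ge_dim_independent) auto
  then have "u \<in> span B" by auto
  then obtain c where "u = (\<Sum>v\<in>B. c v *\<^sub>R v)"
    using fin by (auto simp: span_finite)
  then show ?thesis using coeff by (simp cong: sum.cong)
qed

lemma orthonormal_frame_trace:
  fixes b :: "'e::euclidean_space \<Rightarrow> 'e \<Rightarrow> real" and \<alpha> :: "'e \<Rightarrow> 'e \<Rightarrow> 'k::real_vector"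
  assumes b: "bilinear b" "\<And>u v. b u v = b v u" and \<alpha>: "bilinear \<alpha>"
    and B: "orthonormal_frame b B" and C: "orthonormal_frame b C"
  shows "(\<Sum>v\<in>B. \<alpha> v v) = (\<Sum>w\<in>C. \<alpha> w w)"
proof -
  have fin: "finite C" using C by (simp add: orthonormal_frame_def)
  have "(\<Sum>v\<in>B. \<alpha> v v) = (\<Sum>v\<in>B. \<Sum>w\<in>C. \<Sum>w'\<in>C. (b v w * b v w') *\<^sub>R \<alpha> w w')"
  proof (rule sum.cong[OF refl])
    fix v assume "v \<in> B"
    have "\<alpha> v v = \<alpha> (\<Sum>w\<in>C. b v w *\<^sub>R w) (\<Sum>w'\<in>C. b v w' *\<^sub>R w')"
      using orthonormal_frame_expansion[OF b(1) C, of v] by simp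
    also have "\<dots> = (\<Sum>w\<in>C. \<Sum>w'\<in>C. (b v w * b v w') *\<^sub>R \<alpha> w w')"
      by (simp add: bilinear_sum[OF \<alpha>] bilinear_lmul[OF \<alpha>] bilinear_rmul[OF \<alpha>] sum.cartesian_product mult.commute)
    finally show "\<alpha> v v = (\<Sum>w\<in>C. \<Sum>w'\<in>C. (b v w * b v w') *\<^sub>R \<alpha> w w')" .
  qed
  also have "\<dots> = (\<Sum>w\<in>C. \<Sum>w'\<in>C. \<Sum>v\<in>B. (b v w * b v w') *\<^sub>R \<alpha> w w')"
    by (subst sum.swap, rule sum.cong[OF refl], subst sum.swap, rule refl)
  \<comment> \<open>Parseval's identity for the frame \<open>B\<close>: the sum over
    \<open>B\<close> of the products of coefficients of \<open>w\<close> and \<open>w'\<close> is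
    \<open>b w w'\<close>.\<close>
  also have "\<dots> = (\<Sum>w\<in>C. \<Sum>w'\<in>C. b w w' *\<^sub>R \<alpha> w w')"
  proof (intro sum.cong refl)
    fix w w'
    have "b w w' = b (\<Sum>v\<in>B. b w v *\<^sub>R v) w'"
      using orthonormal_frame_expansion[OF b(1) B, of w] by simp
    also have "\<dots> = (\<Sum>v\<in>B. b (b w v *\<^sub>R v) w')"
      using b(1) by (intro linear_sum) (simp add: bilinear_def)
    also have "\<dots> = (\<Sum>v\<in>B. b v w * b v w')"
      by (simp add: bilinear_lmul[OF b(1)] b(2)[of w])
    finally show "(\<Sum>v\<in>B. (b v w * b v w') *\<^sub>R \<alpha> w w') = b w w' *\<^sub>R \<alpha> w w'"
      by (simp add: scaleR_sum_left)
  qed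
  also have "\<dots> = (\<Sum>w\<in>C. \<Sum>w'\<in>C. if w = w' then \<alpha> w w' else 0)"
    using C by (intro sum.cong refl) (auto simp: orthonormal_frame_def)
  also have "\<dots> = (\<Sum>w\<in>C. \<alpha> w w)" using fin by simp
  finally show ?thesis .
qed

section \<open>Real Kaehler submanifolds\<close>

locale kaehler_immersion =
  fixes A :: "('m::{t2_space,second_countable_topology}, 'e::euclidean_space) chart set"
    and g :: "'m \<Rightarrow> 'e \<Rightarrow> 'e \<Rightarrow> real" and J :: "'m \<Rightarrow> 'e \<Rightarrow> 'e" and f :: "'m \<Rightarrow> real^'n"
  assumes kaehler: "kaehler_manifold A g J" and immersion: "isometric_immersion A g f"
begin

section \<open>Charts and changes of coordinates\<close>

lemma chart_at: "chart_at A x \<in> A" "x \<in> fst (chart_at A x)"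
proof -
  have "(\<Union>c\<in>A. fst c) = UNIV"
    using kaehler unfolding kaehler_manifold_def smooth_atlas_def by blast
  then have "\<exists>c. c \<in> A \<and> x \<in> fst c" by blast
  then show "chart_at A x \<in> A" "x \<in> fst (chart_at A x)"
    unfolding chart_at_def by (metis (mono_tags, lifting) someI_ex)+
qed

lemma chart:
  assumes "c \<in> A"
  shows "open (fst c)" "open (chart_img c)"
    "homeomorphism (fst c) (chart_img c) (snd c) (chart_inv c)"
  using kaehler assms by (auto simp: kaehler_manifold_def smooth_atlas_def)

lemma chart_inverse:
  assumes "c \<in> A"
  shows "x \<in> fst c \<Longrightarrow> chart_inv c (snd c x) = x" "x \<in> fst c \<Longrightarrow> snd c x \<in> chart_img c"
    "y \<in> chart_img c \<Longrightarrow> snd c (chart_inv c y) = y" "y \<in> chart_img c \<Longrightarrow> chart_inv c y \<in> fst c"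
  using chart(3)[OF assms] by (auto simp: homeomorphism_def)

definition overlap :: "('m, 'e) chart \<Rightarrow> ('m, 'e) chart \<Rightarrow> 'e set" where
  "overlap c d = snd c ` (fst c \<inter> fst d)"

definition transition :: "('m, 'e) chart \<Rightarrow> ('m, 'e) chart \<Rightarrow> 'e \<Rightarrow> 'e" where
  "transition c d = snd d \<circ> chart_inv c"

lemma open_overlap:
  assumes "c \<in> A" "d \<in> A"
  shows "open (overlap c d)"
proof -
  have "overlap c d = chart_inv c -` fst d \<inter> chart_img c"
    using chart_inverse[OF assms(1)] by (force simp: overlap_def)
  moreover have "continuous_on (chart_img c) (chart_inv c)"
    using chart(3)[OF assms(1)] by (simp add: homeomorphism_def)
  ultimately show ?thesis
    using continuous_on_open_vimage[OF chart(2)[OF assms(1)]] chart(1)[OF assms(2)] by metis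
qed

lemma transition_C_k:
  assumes "c \<in> A" "d \<in> A"
  shows "C_k_on k (transition c d) (overlap c d)"
  using kaehler assms
  by (simp add: kaehler_manifold_def smooth_atlas_def smooth_on_def transition_def overlap_def)

lemma transition_has_derivative:
  assumes "c \<in> A" "d \<in> A" "x \<in> fst c" "x \<in> fst d"
  shows "(transition c d has_derivative coord_change c d x) (at (snd c x))"
  using transition_C_k[OF assms(1,2), of 1] assms(3,4)
  by (auto simp: overlap_def transition_def coord_change_def frechet_derivative_works[symmetric])

lemma coord_change_linear:
  assumes "c \<in> A" "d \<in> A" "x \<in> fst c" "x \<in> fst d"
  shows "linear (coord_change c d x)"
  by (rule has_derivative_linear[OF transition_has_derivative[OF assms]])

lemma coord_change_self:
  assumes "c \<in> A" "x \<in> fst c"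
  shows "coord_change c c x = (\<lambda>u. u)"
proof -
  have "((\<lambda>y. y) has_derivative (\<lambda>u. u)) (at (snd c x))" by simp
  then have "(transition c c has_derivative (\<lambda>u. u)) (at (snd c x))"
    by (rule has_derivative_transform_within_open[OF _ chart(2)[OF assms(1)]])
       (use assms chart_inverse in \<open>auto simp: transition_def\<close>)
  then show ?thesis
    using has_derivative_unique transition_has_derivative[OF assms(1,1,2,2)] by blast
qed

lemma coord_change_trans:
  assumes "c \<in> A" "d \<in> A" "e \<in> A" "x \<in> fst c" "x \<in> fst d" "x \<in> fst e"
  shows "coord_change d e x (coord_change c d x u) = coord_change c e x u"
proof -
  have eq: "transition c d (snd c x) = snd d x"
    using assms chart_inverse by (simp add: transition_def)
  have "(transition d e \<circ> transition c d has_derivative coord_change d e x \<circ> coord_change c d x)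
      (at (snd c x))"
    by (rule diff_chain_at) (use transition_has_derivative assms eq in auto)
  then have "(transition c e has_derivative coord_change d e x \<circ> coord_change c d x) (at (snd c x))"
    by (rule has_derivative_transform_within_open[OF _ open_overlap[OF assms(1,2)]])
       (use assms chart_inverse(1)[OF assms(1)] chart_inverse(1)[OF assms(2)] in \<open>auto simp: transition_def overlap_def\<close>)
  then have "coord_change d e x \<circ> coord_change c d x = coord_change c e x"
    using has_derivative_unique transition_has_derivative[OF assms(1,3,4,6)] by blast
  then show ?thesis by (metis comp_apply)
qed

lemma coord_change_inverse:
  assumes "c \<in> A" "d \<in> A" "x \<in> fst c" "x \<in> fst d"
  shows "coord_change d c x (coord_change c d x u) = u"
  using coord_change_trans[OF assms(1,2,1,3,4,3)] coord_change_self[OF assms(1,3)] by simp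

lemma f_smooth: "c \<in> A \<Longrightarrow> smooth_on (f \<circ> chart_inv c) (chart_img c)"
  using immersion by (simp add: isometric_immersion_def)

lemma f_has_derivative:
  assumes "c \<in> A" "y \<in> chart_img c"
  shows "(f \<circ> chart_inv c has_derivative frechet_derivative (f \<circ> chart_inv c) (at y)) (at y)"
proof -
  have "C_k_on 1 (f \<circ> chart_inv c) (chart_img c)"
    using f_smooth[OF assms(1)] by (simp add: smooth_on_def)
  then show ?thesis using assms(2) by (simp add: frechet_derivative_works)
qed

lemma frechet_derivative_change_chart:
  assumes "c \<in> A" "d \<in> A" "x \<in> fst c" "x \<in> fst d"
  shows "frechet_derivative (f \<circ> chart_inv c) (at (snd c x)) u =
    frechet_derivative (f \<circ> chart_inv d) (at (snd d x)) (coord_change c d x u)"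
proof -
  have eq: "transition c d (snd c x) = snd d x"
    using assms chart_inverse by (simp add: transition_def)
  have "((f \<circ> chart_inv d) \<circ> transition c d has_derivative
      frechet_derivative (f \<circ> chart_inv d) (at (snd d x)) \<circ> coord_change c d x) (at (snd c x))"
    by (rule diff_chain_at)
       (use transition_has_derivative assms eq f_has_derivative chart_inverse in auto)
  then have "(f \<circ> chart_inv c has_derivative
      frechet_derivative (f \<circ> chart_inv d) (at (snd d x)) \<circ> coord_change c d x) (at (snd c x))"
    by (rule has_derivative_transform_within_open[OF _ open_overlap[OF assms(1,2)]])
       (use assms chart_inverse(1)[OF assms(1)] chart_inverse(1)[OF assms(2)] in \<open>auto simp: transition_def overlap_def\<close>)
  then show ?thesis by (simp add: frechet_derivative_eqI)
qed

lemma derivative_eq_differential: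
  assumes "c \<in> A" "y \<in> chart_img c"
  defines "x \<equiv> chart_inv c y"
  shows "frechet_derivative (f \<circ> chart_inv c) (at y) u =
    differential A f x (coord_change c (chart_at A x) x u)"
  using frechet_derivative_change_chart[OF assms(1) chart_at(1)[of x] _ chart_at(2)[of x], of u]
    chart_inverse[OF assms(1)] assms(2)
  by (simp add: differential_def x_def)

lemma J_linear: "linear (J x)" and JJ: "J x (J x u) = - u" and gJ: "g x (J x u) (J x v) = g x u v"
  using kaehler by (auto simp: kaehler_manifold_def almost_complex_structure_def)

lemma differential_inj: "inj (differential A f x)"
  and g_differential: "g x u v = differential A f x u \<bullet> differential A f x v"
  using immersion by (auto simp: isometric_immersion_def)

text \<open>The coordinate change \<open>T\<close> to the preferred chart at the point is a linear
  isomorphism and carries over the algebraic properties.\<close>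

lemma kaehler_chart:
  assumes c: "c \<in> A"
  shows "kaehler_chart (chart_img c) (f \<circ> chart_inv c) (endo_in A J c) (metric_in A g c)"
proof (rule kaehler_chart.intro)
  show "open (chart_img c)" by (rule chart(2)[OF c])
  show "smooth_on (f \<circ> chart_inv c) (chart_img c)" by (rule f_smooth[OF c])
  show "smooth_on (\<lambda>y. endo_in A J c y v) (chart_img c)" for v
    using kaehler c by (simp add: kaehler_manifold_def almost_complex_structure_def)
  fix y u v assume y: "y \<in> chart_img c"
  define x where "x = chart_inv c y"
  define T where "T = coord_change c (chart_at A x) x"
  define T' where "T' = coord_change (chart_at A x) c x"
  have x: "x \<in> fst c" using chart_inverse[OF c] y by (simp add: x_def)
  have T: "linear T" "linear T'" "\<And>u. T' (T u) = u" "\<And>u. T (T' u) = u"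
    unfolding T_def T'_def
    using coord_change_linear coord_change_inverse c x chart_at by blast+
  have F: "frechet_derivative (f \<circ> chart_inv c) (at y) u = differential A f x (T u)" for u
    using derivative_eq_differential[OF c y] by (simp add: x_def T_def)
  have K: "endo_in A J c y u = T' (J x (T u))" for u
    by (simp add: endo_in_def Let_def x_def T_def T'_def)
  have G: "metric_in A g c y u v = g x (T u) (T v)" for u v
    by (simp add: metric_in_def Let_def x_def T_def)
  show "inj (frechet_derivative (f \<circ> chart_inv c) (at y))"
    by (rule injI) (metis F T(3) differential_inj injD)
  show "linear (endo_in A J c y)"
    using linear_compose[OF linear_compose[OF T(1) J_linear[of x]] T(2)]
    by (simp add: K[abs_def] o_def)
  show "endo_in A J c y (endo_in A J c y v) = - v"
    by (simp add: K T JJ linear_neg[OF T(2)])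
  show "metric_in A g c y u v =
      frechet_derivative (f \<circ> chart_inv c) (at y) u \<bullet> frechet_derivative (f \<circ> chart_inv c) (at y) v"
    by (simp add: F G g_differential)
  show "metric_in A g c y (endo_in A J c y u) (endo_in A J c y v) = metric_in A g c y u v"
    by (simp add: K G T gJ)
  show "frechet_derivative (\<lambda>y'. endo_in A J c y' v) (at y) u +
      levi_civita (metric_in A g c) y u (endo_in A J c y v) =
      endo_in A J c y (levi_civita (metric_in A g c) y u v)"
    using kaehler c y by (simp add: kaehler_manifold_def parallel_endo_def)
qed

section \<open>The second fundamental form in an arbitrary chart\<close>

definition chart_sff :: "('m, 'e) chart \<Rightarrow> 'e \<Rightarrow> 'e \<Rightarrow> 'e \<Rightarrow> real^'n" where
  "chart_sff c = kaehler_chart.sff (f \<circ> chart_inv c)"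

lemma second_ff_eq: "second_ff A f x = chart_sff (chart_at A x) (snd (chart_at A x) x)"
proof -
  interpret C: kaehler_chart "chart_img (chart_at A x)" "f \<circ> chart_inv (chart_at A x)"
      "endo_in A J (chart_at A x)" "metric_in A g (chart_at A x)"
    by (rule kaehler_chart[OF chart_at(1)])
  show ?thesis
    by (intro ext)
       (simp add: second_ff_def chart_sff_def C.sff_def C.D2_def C.D1_def[abs_def]
        normal_space_def differential_def[abs_def])
qed

lemma endo_in_chart_at: "endo_in A J (chart_at A x) (snd (chart_at A x) x) = J x"
  by (intro ext)
     (simp add: endo_in_def Let_def chart_inverse[OF chart_at(1) ] chart_at(2)
       coord_change_self[OF chart_at])

lemma kaehler_form_second_ff: "kaehler_form (second_ff A f x) (J x)"
  using kaehler_chart.kaehler_form_sff[OF kaehler_chart[OF chart_at(1)]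
      chart_inverse(2)[OF chart_at], of x]
  by (simp add: second_ff_eq chart_sff_def endo_in_chart_at)

text \<open>Second derivatives of the transition map contribute only a tangential term, which the
  normal projection kills. This allows continuity arguments in a fixed chart, while
  \<open>second_ff\<close> uses a chart chosen anew at each point.\<close>

lemma chart_sff_change:
  assumes c: "c \<in> A" and d: "d \<in> A" and x: "x \<in> fst c" "x \<in> fst d"
  shows "chart_sff c (snd c x) u v =
    chart_sff d (snd d x) (coord_change c d x u) (coord_change c d x v)"
proof -
  interpret C: kaehler_chart "chart_img c" "f \<circ> chart_inv c" "endo_in A J c" "metric_in A g c"
    by (rule kaehler_chart[OF c])
  interpret D: kaehler_chart "chart_img d" "f \<circ> chart_inv d" "endo_in A J d" "metric_in A g d"
    by (rule kaehler_chart[OF d])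
  let ?O = "overlap c d" and ?\<phi> = "transition c d" and ?T = "coord_change c d x"
  have O: "open ?O" by (rule open_overlap[OF c d])
  have xO: "snd c x \<in> ?O" using x by (simp add: overlap_def)
  have \<phi>x: "?\<phi> (snd c x) = snd d x" using chart_inverse[OF c] x by (simp add: transition_def)
  have \<phi>_img: "?\<phi> y \<in> chart_img d" if "y \<in> ?O" for y
    using that chart_inverse[OF c] chart_inverse[OF d] by (auto simp: overlap_def transition_def)
  \<comment> \<open>The constant field \<open>v\<close> of chart \<open>c\<close> seen in chart
    \<open>d\<close>, where it is no longer constant; its derivative produces the tangential
    term.\<close>
  define \<psi> where "\<psi> y = frechet_derivative ?\<phi> (at y) v" for y
  have \<psi>T: "\<psi> (snd c x) = ?T v"
    by (simp add: \<psi>_def frechet_derivative_eqI[OF transition_has_derivative[OF c d x]])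
  have "C_k_on 2 ?\<phi> ?O" by (rule transition_C_k[OF c d])
  then have "\<psi> differentiable (at (snd c x))"
    using xO by (simp add: \<psi>_def[abs_def] numeral_2_eq_2)
  then obtain \<psi>' where \<psi>': "(\<psi> has_derivative \<psi>') (at (snd c x))"
    by (auto simp: differentiable_def)
  have D1: "D.D1 (?\<phi> y) (\<psi> y) = C.D1 y v" if y: "y \<in> ?O" for y
  proof -
    obtain z where z: "z \<in> fst c" "z \<in> fst d" "y = snd c z" using y by (auto simp: overlap_def)
    have "\<psi> y = coord_change c d z v"
      by (simp add: \<psi>_def z(3) frechet_derivative_eqI[OF transition_has_derivative[OF c d z(1,2)]])
    then show ?thesis
      using frechet_derivative_change_chart[OF c d z(1,2)] chart_inverse[OF c] z
      by (simp add: C.D1_def D.D1_def transition_def)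
  qed
  have "((\<lambda>y. D.D1 (?\<phi> y) (\<psi> y)) has_derivative
      (\<lambda>u. D.D2 (snd d x) (?T u) (\<psi> (snd c x)) + D.D1 (?\<phi> (snd c x)) (\<psi>' u))) (at (snd c x))"
  proof (rule has_derivative_apply_linear[OF O xO, where L = "\<lambda>y. D.D1 (?\<phi> y)"
        and L' = "\<lambda>w u. D.D2 (snd d x) (?T u) w"])
    show "linear (D.D1 (?\<phi> y))" if "y \<in> ?O" for y
      using D.D1_linear[OF \<phi>_img[OF that]] .
    fix w
    have "((\<lambda>y. D.D1 y w) has_derivative (\<lambda>u. D.D2 (snd d x) u w)) (at (?\<phi> (snd c x)))"
      using D.D1_has_derivative[OF \<phi>_img[OF xO]] by (simp add: \<phi>x)
    from diff_chain_at[OF transition_has_derivative[OF c d x] this]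
    show "((\<lambda>y. D.D1 (?\<phi> y) w) has_derivative (\<lambda>u. D.D2 (snd d x) (?T u) w)) (at (snd c x))"
      by (simp add: o_def)
  qed (rule \<psi>')
  then have "((\<lambda>y. C.D1 y v) has_derivative
      (\<lambda>u. D.D2 (snd d x) (?T u) (?T v) + D.D1 (snd d x) (\<psi>' u))) (at (snd c x))"
    unfolding \<psi>T \<phi>x by (rule has_derivative_transform_within_open[OF _ O xO]) (rule D1)
  then have D2: "C.D2 (snd c x) u v = D.D2 (snd d x) (?T u) (?T v) + D.D1 (snd d x) (\<psi>' u)"
    by (simp add: C.D2_def frechet_derivative_eqI)
  have xd: "snd d x \<in> chart_img d" using chart_inverse[OF d] x by simp
  have D1T: "C.D1 (snd c x) w = D.D1 (snd d x) (?T w)" for w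
    using frechet_derivative_change_chart[OF c d x] by (simp add: C.D1_def D.D1_def)
  have "range (C.D1 (snd c x)) = range (D.D1 (snd d x))"
  proof
    show "range (D.D1 (snd d x)) \<subseteq> range (C.D1 (snd c x))"
      using coord_change_inverse[OF d c x(2,1)] by (auto simp: D1T) (metis rangeI)
  qed (auto simp: D1T)
  moreover have "orth_proj ((range (D.D1 (snd d x)))\<^sup>\<bottom>) (D.D1 (snd d x) (\<psi>' u)) = 0"
    using D.orth_proj_D1[OF xd] by blast
  ultimately show ?thesis
    by (simp add: chart_sff_def C.sff_def D.sff_def D2
        linear_add[OF linear_orth_proj[OF subspace_orthogonal_comp]])
qed

lemma second_ff_change:
  assumes "c \<in> A" "x \<in> fst c"
  defines "T \<equiv> coord_change c (chart_at A x) x"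
  shows "chart_sff c (snd c x) u v = second_ff A f x (T u) (T v)"
    "T (endo_in A J c (snd c x) u) = J x (T u)"
proof -
  show "chart_sff c (snd c x) u v = second_ff A f x (T u) (T v)"
    unfolding T_def second_ff_eq
    by (rule chart_sff_change) (use assms chart_at in auto)
  show "T (endo_in A J c (snd c x) u) = J x (T u)"
    using coord_change_inverse[OF chart_at(1) assms(1) chart_at(2) assms(2)] assms(1,2)
    by (simp add: endo_in_def Let_def chart_inverse T_def)
qed

section \<open>Pluriharmonic points: vanishing of the (1,1)-part of the second fundamental
  form\<close>

definition pluriharmonic_at :: "'m \<Rightarrow> bool" where
  "pluriharmonic_at x \<longleftrightarrow> (\<forall>u v. second_ff A f x u v + second_ff A f x (J x u) (J x v) = 0)"

text \<open>For fixed coordinate vectors in one fixed chart, failure is an open condition, so it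
  would occur at a point of \<open>U\<close>; tensoriality relates that failure to the preferred
  chart there.\<close>

lemma pluriharmonic_dense:
  assumes "closure U = UNIV" "\<And>x. x \<in> U \<Longrightarrow> pluriharmonic_at x"
  shows "pluriharmonic_at x"
proof (rule ccontr)
  let ?c = "chart_at A x"
  assume "\<not> pluriharmonic_at x"
  then obtain u v where uv: "second_ff A f x u v + second_ff A f x (J x u) (J x v) \<noteq> 0"
    by (auto simp: pluriharmonic_at_def)
  interpret C: kaehler_chart "chart_img ?c" "f \<circ> chart_inv ?c" "endo_in A J ?c" "metric_in A g ?c"
    by (rule kaehler_chart[OF chart_at(1)])
  have "C.sff (snd ?c x) u v + C.sff (snd ?c x) (endo_in A J ?c (snd ?c x) u) (endo_in A J ?c (snd ?c x) v) \<noteq> 0"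
    using uv by (simp add: second_ff_eq chart_sff_def endo_in_chart_at)
  then have "\<forall>\<^sub>F y in nhds (snd ?c x). C.sff y u v + C.sff y (endo_in A J ?c y u) (endo_in A J ?c y v) \<noteq> 0"
    by (rule C.eventually_not_pluriharmonic[OF chart_inverse(2)[OF chart_at]])
  then obtain N where N: "open N" "snd ?c x \<in> N"
    "\<And>y. y \<in> N \<Longrightarrow> C.sff y u v + C.sff y (endo_in A J ?c y u) (endo_in A J ?c y v) \<noteq> 0"
    by (auto simp: eventually_nhds)
  have "continuous_on (fst ?c) (snd ?c)"
    using chart(3)[OF chart_at(1)] by (simp add: homeomorphism_def)
  then have "open (snd ?c -` N \<inter> fst ?c)"
    using continuous_on_open_vimage[OF chart(1)[OF chart_at(1)]] N(1) by blast
  moreover have "x \<in> snd ?c -` N \<inter> fst ?c" using N(2) chart_at by simp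
  ultimately obtain z where z: "z \<in> U" "z \<in> fst ?c" "snd ?c z \<in> N"
    using assms(1) open_Int_closure_eq_empty[of "snd ?c -` N \<inter> fst ?c" U] by blast
  note change = second_ff_change[OF chart_at(1) z(2)]
  have "C.sff (snd ?c z) u v +
      C.sff (snd ?c z) (endo_in A J ?c (snd ?c z) u) (endo_in A J ?c (snd ?c z) v) = 0"
    using assms(2)[OF z(1)] change(1)
    by (simp add: chart_sff_def[symmetric] change pluriharmonic_at_def)
  then show False using N(3)[OF z(3)] by blast
qed

section \<open>Orthonormal frames and the mean curvature\<close>

lemma g_bilinear: "bilinear (g x)" and g_commute: "g x u v = g x v u"
  using kaehler by (auto simp: kaehler_manifold_def riemannian_metric_def)

text \<open>Pull back an orthonormal basis of the image of the differential. Existence gives the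
  \<open>SOME\<close> in \<open>mean_curvature\<close> its meaning.\<close>

lemma ex_orthonormal_frame: "\<exists>B. orthonormal_frame (g x) B"
proof -
  let ?L = "differential A f x"
  have lin: "linear ?L"
    unfolding differential_def
    using f_has_derivative[OF chart_at(1) chart_inverse(2)[OF chart_at]] has_derivative_linear by blast
  then have "subspace (range ?L)" by (simp add: linear_subspace_image)
  then obtain C where C: "C \<subseteq> range ?L" "pairwise orthogonal C" "\<And>w. w \<in> C \<Longrightarrow> norm w = 1"
      "independent C" "card C = dim (range ?L)"
    using orthonormal_basis_subspace by metis
  have "dim (range ?L) = DIM('e)"
    using dim_image_eq[OF lin, of UNIV] differential_inj by simp
  moreover define B where "B = ?L -` C"
  have LB: "?L ` B = C" using C(1) by (auto simp: B_def)
  have injB: "inj_on ?L B" using differential_inj by (rule inj_on_subset) simp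
  have "finite B"
    using finite_vimageI[OF independent_imp_finite[OF C(4)] differential_inj] by (simp add: B_def)
  moreover have "card B = card C" using card_image[OF injB] LB by simp
  moreover have "g x u v = (if u = v then 1 else 0)" if "u \<in> B" "v \<in> B" for u v
  proof (cases "u = v")
    case True
    then show ?thesis using C(3)[of "?L u"] that by (simp add: B_def g_differential dot_square_norm)
  next
    case False
    then have "?L u \<noteq> ?L v" using differential_inj by (auto dest: injD)
    then show ?thesis
      using C(2) that False by (auto simp: B_def g_differential pairwise_def orthogonal_def)
  qed
  ultimately show ?thesis using C(5) by (auto simp: orthonormal_frame_def)
qed

lemma mean_curvature_0:
  assumes "pluriharmonic_at x"
  shows "mean_curvature A g f x = 0"
proof -
  define B where "B = (SOME B. orthonormal_frame (g x) B)"
  have B: "orthonormal_frame (g x) B"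
    unfolding B_def using ex_orthonormal_frame by (rule someI_ex)
  have inj: "inj_on (J x) B"
    by (rule inj_onI) (metis JJ neg_equal_iff_equal)
  have "orthonormal_frame (g x) (J x ` B)"
    using B inj by (auto simp: orthonormal_frame_def card_image gJ inj_on_eq_iff)
  then have "(\<Sum>v\<in>B. second_ff A f x v v) = (\<Sum>v\<in>J x ` B. second_ff A f x v v)"
    using B kaehler_form.bil[OF kaehler_form_second_ff]
    by (intro orthonormal_frame_trace[OF g_bilinear g_commute])
  also have "\<dots> = (\<Sum>v\<in>B. second_ff A f x (J x v) (J x v))"
    using inj by (simp add: sum.reindex)
  also have "\<dots> = (\<Sum>v\<in>B. - second_ff A f x v v)"
    using assms by (simp add: pluriharmonic_at_def add_eq_0_iff)
  also have "\<dots> = - (\<Sum>v\<in>B. second_ff A f x v v)" by (rule sum_negf)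
  finally have "(\<Sum>v\<in>B. second_ff A f x v v) = 0"
    by (simp only: vec_eq_iff) auto
  then show ?thesis by (simp add: mean_curvature_def B_def)
qed

section \<open>Complex nullities\<close>

lemma complex_null_space_eq:
  assumes "subspace V"
  shows "complex_null_space A J f x V = kaehler_form.complex_null (second_ff A f x) (J x) V"
  unfolding complex_null_space_def kaehler_form.complex_null_def[OF kaehler_form_second_ff]
  by (auto simp: orth_proj_eq_0_iff[OF assms] orthogonal_comp_def orthogonal_def)

lemma complex_nullity_ge:
  assumes "subspace V" "V \<subseteq> first_normal_space A f x"
  shows "dim (complex_null_space A J f x V) \<le> complex_nullity A J f (dim V) x"
  unfolding complex_nullity_def
proof (rule Max_ge)
  show "finite {dim (complex_null_space A J f x W) |W.
      subspace W \<and> W \<subseteq> first_normal_space A f x \<and> dim W = dim V}"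
    by (rule finite_subset[of _ "{..DIM('e)}"]) (auto intro: dim_subset_UNIV)
qed (use assms in auto)

text \<open>The witness \<open>l\<close> is the dimension of the value space \<open>L\<close>. The
  guard \<open>l \<noteq> 1\<close> keeps the index \<open>l - 1\<close> at least 1, where
  \<open>complex_nullity\<close> has its intended meaning.\<close>

lemma not_pluriharmonic_nullity:
  assumes "\<not> pluriharmonic_at x"
  shows "\<exists>l\<ge>1. l \<le> first_normal_dim A f x \<and>
    DIM('e) \<le> complex_nullity A J f l x + 2 * l \<and>
    (l \<noteq> 1 \<longrightarrow> DIM('e) \<le> complex_nullity A J f (l - 1) x + 2 * (l - 1))"
proof -
  interpret Q: kaehler_form "second_ff A f x" "J x" by (rule kaehler_form_second_ff)
  let ?L = "Q.value_space"
  have sub: "subspace ?L" by (simp add: Q.value_space_def)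
  have L: "?L \<subseteq> first_normal_space A f x"
    unfolding Q.value_space_def
  proof (rule span_minimal)
    show "subspace (first_normal_space A f x)" by (simp add: first_normal_space_def)
    have "second_ff A f x u v \<in> first_normal_space A f x" for u v
      unfolding first_normal_space_def by (rule span_base) auto
    then show "{vRe (Q.herm X Y) |X Y. True} \<subseteq> first_normal_space A f x"
      by (auto simp: Q.herm_def first_normal_space_def span_add)
  qed
  obtain u v where uv: "second_ff A f x u v + second_ff A f x (J x u) (J x v) \<noteq> 0"
    using assms by (auto simp: pluriharmonic_at_def)
  have "vRe (Q.herm u v) \<in> ?L" unfolding Q.value_space_def by (rule span_base) auto
  then have L0: "?L \<noteq> {0}" using uv by (auto simp: Q.herm_def)
  then have "dim ?L \<ge> 1" using sub by (metis One_nat_def Suc_leI dim_eq_0 gr0I subspace_0 subset_singletonD empty_iff)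
  moreover have "dim ?L \<le> first_normal_dim A f x"
    unfolding first_normal_dim_def by (rule dim_subset[OF L])
  moreover have "DIM('e) \<le> complex_nullity A J f (dim ?L) x + 2 * dim ?L"
    using Q.dim_nullity_space dim_subset[OF Q.nullity_subset] complex_nullity_ge[OF sub L]
    by (simp add: complex_null_space_eq[OF sub])
  moreover have "DIM('e) \<le> complex_nullity A J f (dim ?L - 1) x + 2 * (dim ?L - 1)" if L1: "dim ?L \<noteq> 1"
  proof -
    obtain V where V: "subspace V" "V \<subseteq> ?L" "dim V + 1 = dim ?L"
        "DIM('e) \<le> dim (Q.complex_null V) + 2 * dim V"
      using Q.ex_large_complex_null[OF L0 L1] by blast
    then show ?thesis
      using complex_nullity_ge[OF V(1) subset_trans[OF V(2) L]]
      by (simp add: complex_null_space_eq[OF V(1)] V(3)[symmetric])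
  qed
  ultimately show ?thesis by blast
qed

end

theorem theorem1:
  fixes n p :: nat
    and A :: "('m::{t2_space,second_countable_topology}, real ^ 'd) chart set"
    and g :: "'m \<Rightarrow> real ^ 'd \<Rightarrow> real ^ 'd \<Rightarrow> real"
    and J :: "'m \<Rightarrow> real ^ 'd \<Rightarrow> real ^ 'd"
    and f :: "'m \<Rightarrow> real ^ 'N"
    and U :: "'m set"
  assumes "n \<ge> 2" and "1 \<le> p" and "p \<le> n"
    and "CARD('d) = 2 * n" and "CARD('N) = 2 * n + p"
    and "kaehler_manifold A g J"
    and "isometric_immersion A g f"
    and "open U" and "closure U = UNIV"
    and "\<And>x. x \<in> U \<Longrightarrow>
      ((1 \<le> first_normal_dim A f x \<longrightarrow>
          int (complex_nullity A J f 1 x) < 2 * int n - 2) \<and>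
       (\<forall>s::nat. 1 \<le> s \<and> 2 * s \<le> first_normal_dim A f x \<longrightarrow>
          int (complex_nullity A J f (2 * s) x) < 2 * int n - 4 * int s))
      \<or>
      (\<forall>s::nat. 2 * s + 1 \<le> first_normal_dim A f x \<longrightarrow>
          int (complex_nullity A J f (2 * s + 1) x) < 2 * int n - 4 * int s - 2)"
  shows "minimal_immersion A g f"
proof -
  interpret kaehler_immersion A g J f
    using assms(6,7) by (rule kaehler_immersion.intro)
  have "pluriharmonic_at x" if x: "x \<in> U" for x
  proof (rule ccontr)
    assume "\<not> pluriharmonic_at x"
    then obtain l where l: "l \<ge> 1" "l \<le> first_normal_dim A f x"
        "2 * n \<le> complex_nullity A J f l x + 2 * l"
        "l \<noteq> 1 \<Longrightarrow> 2 * n \<le> complex_nullity A J f (l - 1) x + 2 * (l - 1)"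
      using not_pluriharmonic_nullity[of x] assms(4) by auto
    from assms(10)[OF x] show False
    proof
      assume i: "(1 \<le> first_normal_dim A f x \<longrightarrow>
          int (complex_nullity A J f 1 x) < 2 * int n - 2) \<and>
       (\<forall>s::nat. 1 \<le> s \<and> 2 * s \<le> first_normal_dim A f x \<longrightarrow>
          int (complex_nullity A J f (2 * s) x) < 2 * int n - 4 * int s)"
      \<comment> \<open>Alternative (i) bounds index 1 and the even indices: it is contradicted at
        \<open>l\<close> when \<open>l\<close> is 1 or even, and at \<open>l - 1\<close> when
        \<open>l\<close> is odd and at least 3.\<close>
      consider "l = 1" | s where "l = 2 * s" "1 \<le> s" | s where "l = 2 * s + 1" "1 \<le> s"
        using l(1) by (metis One_nat_def Suc_eq_plus1 Suc_leI add_0 evenE gr0I mult_0_right not_one_le_zero oddE)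
      then show False
      proof cases
        case 1
        then show ?thesis using l(2,3) i by auto
      next
        case 2
        then show ?thesis using l(2,3) i[THEN conjunct2, rule_format, of s] by auto
      next
        case 3
        then show ?thesis using l(2,4) i[THEN conjunct2, rule_format, of s] by auto
      qed
    next
      assume ii: "\<forall>s::nat. 2 * s + 1 \<le> first_normal_dim A f x \<longrightarrow>
          int (complex_nullity A J f (2 * s + 1) x) < 2 * int n - 4 * int s - 2"
      show False
      \<comment> \<open>Alternative (ii) bounds the odd indices: an odd \<open>l\<close> contradicts
        it directly, an even \<open>l\<close> through \<open>l - 1\<close>, which is at least
        1.\<close>
      proof (cases "odd l")
        case True
        then obtain s where "l = 2 * s + 1" by (rule oddE)
        then show ?thesis using l(2,3) ii[rule_format, of s] by auto
      next
        case False
        then obtain k where "l = 2 * k" by auto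
        moreover from this obtain s where "k = Suc s" using l(1) by (cases k) auto
        ultimately show ?thesis using l(2,4) ii[rule_format, of s] by auto
      qed
    qed
  qed
  then have "pluriharmonic_at x" for x
    using pluriharmonic_dense[OF assms(9)] by blast
  then show ?thesis by (simp add: minimal_immersion_def mean_curvature_0)
qed

end
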